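(* Let $\mathcal{S}$ be a bounded measurable subset of $\mathbb{R}^2$, let $f$ be its indicator function, and let $\widetilde{\mathcal{S}}=\{x\in\mathbb{R}^2:\ -x\in\mathcal{S}\}$. Then $$\|\hat f\|_2^2=\frac{1}{\zeta(2)}\left(\operatorname{area}(\mathcal{S})+\operatorname{area}(\mathcal{S}\cap\widetilde{\mathcal{S}})+\sum_{n\ne0}\frac{\varphi(|n|)}{|n|}\int_{\mathcal{S}}|\mathcal{I}^n_x|\,dx\right),$$ where $\varphi$ is Euler's totient function, for $x=(x_1,x_2)$ and nonzero integer $n$ $$\mathcal{I}^n_x=\Big\{t\in\mathbb{R}:\ n\Big(\frac{-x_2}{x_1^2+x_2^2},\frac{x_1}{x_1^2+x_2^2}\Big)+t(x_1,x_2)\in\mathcal{S}\Big\},$$ and $|\mathcal{I}^n_x|$ denotes its Lebesgue measure.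
   Context: $X=\mathrm{SL}_2(\mathbb{R})/\mathrm{SL}_2(\mathbb{Z})$ is the space of unimodular lattices in $\mathbb{R}^2$ and $\mu$ is the $\mathrm{SL}_2(\mathbb{R})$-invariant probability measure on $X$. For a lattice $\Lambda$, $\Lambda_{\mathrm{pr}}$ denotes its set of primitive vectors. For a function $f$ on $\mathbb{R}^2$, its primitive Siegel transform is $\hat f(\Lambda)=\sum_{v\in\Lambda_{\mathrm{pr}}}f(v)$. $\|\cdot\|_2$ is the $L^2(X,\mu)$ norm. $\zeta(2)=\pi^2/6$. *)

theory Defs
  imports "HOL-Analysis.Analysis" "HOL-Number_Theory.Number_Theory"
begin

definition perp2 :: "real^2 \<Rightarrow> real^2" where
  "perp2 x = (\<chi> i. if i = 1 then - (x $ 2) else x $ 1)"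

definition lattice_of :: "real^2 \<Rightarrow> real^2 \<Rightarrow> (real^2) set" where
  "lattice_of u w = {of_int a *\<^sub>R u + of_int b *\<^sub>R w | a b. True}"

definition primitive_vectors :: "(real^2) set \<Rightarrow> (real^2) set" where
  "primitive_vectors L =
     {v \<in> L. v \<noteq> 0 \<and> (\<forall>w\<in>L. \<forall>k::int. v = of_int k *\<^sub>R w \<longrightarrow> \<bar>k\<bar> = 1)}"

definition prim_siegel :: "(real^2 \<Rightarrow> real) \<Rightarrow> (real^2) set \<Rightarrow> real" where
  "prim_siegel f L = (\<Sum>\<^sub>\<infinity> v\<in>primitive_vectors L. f v)"

text \<open>Coordinates on SL_2(R): (v,t) with v \<noteq> 0 is the matrix with columns
  v and perp2 v / |v|^2 + t v (determinant 1). Every g in SL_2(R) arises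
  uniquely this way, and in these coordinates the Haar measure of SL_2(R) is
  Lebesgue measure dv dt on R^2 x R.\<close>
definition sl2_col2 :: "real^2 \<Rightarrow> real \<Rightarrow> real^2" where
  "sl2_col2 v t = (1 / (norm v)\<^sup>2) *\<^sub>R perp2 v + t *\<^sub>R v"

definition sl2_lattice :: "(real^2) \<times> real \<Rightarrow> (real^2) set" where
  "sl2_lattice p = lattice_of (fst p) (sl2_col2 (fst p) (snd p))"

text \<open>Fundamental domain for SL_2(R)/SL_2(Z) (Gauss-reduced bases:
  |v1| \<le> |v2|, |v1 . v2| \<le> |v1|^2/2), covering almost every coset
  the same number of times (twice, because of -I).\<close>
definition fund_dom :: "((real^2) \<times> real) set" where
  "fund_dom = {(v, t). v \<noteq> 0 \<and> \<bar>t\<bar> \<le> 1/2 \<and> norm v \<le> norm (sl2_col2 v t)}"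

text \<open>Integral over X = SL_2(R)/SL_2(Z) w.r.t. the invariant probability
  measure mu: normalized Haar integral over the fundamental domain.\<close>
definition X_integral :: "((real^2) set \<Rightarrow> real) \<Rightarrow> real" where
  "X_integral F =
     (\<integral>p. F (sl2_lattice p) \<partial>(lebesgue_on fund_dom)) / measure lebesgue fund_dom"

definition L2_norm_sq :: "((real^2) set \<Rightarrow> real) \<Rightarrow> real" where
  "L2_norm_sq F = X_integral (\<lambda>L. (F L)\<^sup>2)"

definition I_set :: "(real^2) set \<Rightarrow> int \<Rightarrow> real^2 \<Rightarrow> real set" where
  "I_set S n x = {t::real. of_int n *\<^sub>R ((1 / (norm x)\<^sup>2) *\<^sub>R perp2 x) + t *\<^sub>R x \<in> S}"

end

theory Submission
  imports Defs
begin

text \<open>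
  Write \<open>F\<close> for the reduced domain, which meets almost every orbit of \<open>SL\<^sub>2(\<int>)\<close> exactly twice, so that
  \<open>\<integral>\<^sub>F (\<Sum>\<gamma>. G (p \<gamma>)) dp = 2 \<integral> G\<close> for every nonnegative \<open>G\<close>. For
  \<open>G (v, t) = 1\<^bsub>[0,1)\<^esub>(t) f(v) h^(v, t)\<close>, with \<open>h^\<close> the Siegel transform, which is invariant under \<open>SL\<^sub>2(\<int>)\<close>,
  the sum over \<open>\<gamma>\<close> is \<open>f^ h^\<close>: each primitive vector is the first column of exactly one
  \<open>p \<gamma>\<close> with \<open>t \<in> [0,1)\<close>. On the right-hand side \<open>h^\<close> is expanded over the primitive vectors
  \<open>k v + n w\<close>; the terms with \<open>n = 0\<close> give \<open>h(v) + h(-v)\<close>, and for \<open>n \<noteq> 0\<close> the unit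
  intervals of \<open>t\<close> belonging to the \<open>k\<close> coprime to \<open>n\<close> cover a line \<open>\<phi>(\<bar>n\<bar>)\<close> times.

  Right invariance of \<open>dv dt\<close> comes from Lebesgue measure on \<open>2 \<times> 2\<close> matrices: rescaling the
  matrices with determinant in \<open>[1,2]\<close> to determinant 1 pushes it forward to \<open>dv dt\<close>.
\<close>

section \<open>Unimodular substitutions\<close>

text \<open>All averaging is done in \<open>ennreal\<close>: Tonelli then applies without
  integrability, so the two-function formula holds for arbitrary nonnegative Borel \<open>f\<close>
  and \<open>h\<close>. Boundedness of \<open>S\<close> enters only afterwards, when values must be
  known to be finite before returning to real integrals and sums. The constant arises from two
  sources. The 2 counts I and -I, and the domain has volume \<open>pi\<^sup>2 / 3\<close>, which is
  twice zeta(2); the quotient is 1 / zeta(2). SL_2(R) is a null set among the 2 x 2 matrices, so its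
  Haar measure is not a restriction of Lebesgue measure. It has to be thickened in the direction of
  the determinant, which right multiplication by determinant 1 leaves alone. A second obstacle is
  that \<open>S\<close> is merely Lebesgue measurable. Lattices and lines are themselves null sets
  of the plane, so changing \<open>S\<close> on a null set could alter both sides; that it does so
  only for negligibly many lattices and lines needs a proof.\<close>

lemma nn_integral_lborel_affine:
  fixes f :: "'a::euclidean_space \<Rightarrow> ennreal"
  assumes [measurable]: "f \<in> borel_measurable borel" and c: "c \<noteq> 0"
  shows "(\<integral>\<^sup>+x. f x \<partial>lborel) = ennreal (\<bar>c\<bar> ^ DIM('a)) * (\<integral>\<^sup>+x. f (t + c *\<^sub>R x) \<partial>lborel)"
proof -
  have [measurable]: "(\<lambda>x. t + c *\<^sub>R x) \<in> borel_measurable borel" by simp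
  show ?thesis
  by (subst lborel_affine[OF c, of t])
     (simp add: nn_integral_density nn_integral_distr nn_integral_cmult)
qed

text \<open>If \<open>c = 0\<close> the substitution is triangular: scale \<open>x\<close>, then
  scale and translate \<open>y\<close>. Otherwise \<open>u = a x + c y\<close> replaces
  \<open>y\<close>, the order of integration is exchanged, and the second component is affine in
  \<open>x\<close> for fixed \<open>u\<close>; the Jacobians \<open>\<bar>c\<bar>\<close> and
  \<open>1 / \<bar>c\<bar>\<close> cancel. It serves both for points of the plane (\<open>'a\<close>
  the reals) and for pairs of matrix columns (\<open>'a\<close> the plane).\<close>

lemma nn_integral_unimodular:
  fixes f :: "'a::euclidean_space \<times> 'a \<Rightarrow> ennreal" and a b c d :: real
  assumes f [measurable]: "f \<in> borel_measurable borel" and det: "\<bar>a * d - b * c\<bar> = 1"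
  shows "(\<integral>\<^sup>+x. \<integral>\<^sup>+y. f (a *\<^sub>R x + c *\<^sub>R y, b *\<^sub>R x + d *\<^sub>R y) \<partial>lborel \<partial>lborel)
       = (\<integral>\<^sup>+x. \<integral>\<^sup>+y. f (x, y) \<partial>lborel \<partial>lborel)"
proof (cases "c = 0")
  case True
  define K where "K = DIM('a)"
  have f': "f \<in> borel_measurable (borel \<Otimes>\<^sub>M borel)" using f by (simp add: borel_prod)
  have ad: "\<bar>a\<bar> * \<bar>d\<bar> = 1" "a \<noteq> 0" "d \<noteq> 0" using det True by (auto simp: abs_mult)
  have 1: "(\<integral>\<^sup>+y. f (x, y) \<partial>lborel)
     = ennreal (\<bar>d\<bar> ^ K) * (\<integral>\<^sup>+y. f (x, s + d *\<^sub>R y) \<partial>lborel)" for x s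
    unfolding K_def using ad f' by (intro nn_integral_lborel_affine) measurable
  have "(\<integral>\<^sup>+x. \<integral>\<^sup>+y. f (x, y) \<partial>lborel \<partial>lborel)
     = ennreal (\<bar>a\<bar> ^ K) * (\<integral>\<^sup>+x. \<integral>\<^sup>+y. f (0 + a *\<^sub>R x, y) \<partial>lborel \<partial>lborel)"
    unfolding K_def using ad f' by (intro nn_integral_lborel_affine) measurable
  also have "\<dots> = ennreal (\<bar>a\<bar> ^ K) * (\<integral>\<^sup>+x. ennreal (\<bar>d\<bar> ^ K) *
        (\<integral>\<^sup>+y. f (a *\<^sub>R x, b *\<^sub>R x + d *\<^sub>R y) \<partial>lborel) \<partial>lborel)"
    by (simp add: 1[of "a *\<^sub>R x" "b *\<^sub>R x" for x])
  also have "\<dots> = ennreal (\<bar>a\<bar> ^ K) * (ennreal (\<bar>d\<bar> ^ K) *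
        (\<integral>\<^sup>+x. \<integral>\<^sup>+y. f (a *\<^sub>R x, b *\<^sub>R x + d *\<^sub>R y) \<partial>lborel \<partial>lborel))"
    using f' by (subst nn_integral_cmult) measurable
  also have "\<dots> = (\<integral>\<^sup>+x. \<integral>\<^sup>+y. f (a *\<^sub>R x, b *\<^sub>R x + d *\<^sub>R y) \<partial>lborel \<partial>lborel)"
    using ad by (simp add: mult.assoc[symmetric] ennreal_mult[symmetric] power_mult_distrib[symmetric])
  finally show ?thesis using True by simp
next
  case False
  define K where "K = DIM('a)"
  have f': "f \<in> borel_measurable (borel \<Otimes>\<^sub>M borel)" using f by (simp add: borel_prod)
  \<comment> \<open>The vector \<open>b x + d y\<close>, expressed through \<open>x\<close> and
    \<open>u = a x + c y\<close>.\<close>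
  let ?g = "\<lambda>u x. f (u, (d / c) *\<^sub>R u - ((a * d - b * c) / c) *\<^sub>R x)"
  have D: "- (a * d - b * c) / c \<noteq> 0"
    using det False by (metis abs_minus_cancel abs_zero divide_eq_0_iff zero_neq_one)
  have 1: "(\<integral>\<^sup>+u. ?g u x \<partial>lborel)
     = ennreal (\<bar>c\<bar> ^ K) * (\<integral>\<^sup>+y. f (a *\<^sub>R x + c *\<^sub>R y, b *\<^sub>R x + d *\<^sub>R y) \<partial>lborel)" for x
  proof -
    have *: "(d / c) *\<^sub>R (a *\<^sub>R x + c *\<^sub>R y) - ((a * d - b * c) / c) *\<^sub>R x = b *\<^sub>R x + d *\<^sub>R y" for y
      using False by (simp add: scaleR_add_right scaleR_diff_left[symmetric] field_simps)
       (simp add: scaleR_diff_left diff_divide_distrib)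
    have "(\<integral>\<^sup>+u. ?g u x \<partial>lborel)
     = ennreal (\<bar>c\<bar> ^ K) * (\<integral>\<^sup>+y. ?g (a *\<^sub>R x + c *\<^sub>R y) x \<partial>lborel)"
      unfolding K_def using False f' by (intro nn_integral_lborel_affine) measurable
    then show ?thesis unfolding * .
  qed
  have 2: "(\<integral>\<^sup>+y. f (u, y) \<partial>lborel) =
     ennreal ((1 / \<bar>c\<bar>) ^ K) * (\<integral>\<^sup>+x. ?g u x \<partial>lborel)" for u
  proof -
    have "(\<integral>\<^sup>+y. f (u, y) \<partial>lborel) = ennreal (\<bar>- (a * d - b * c) / c\<bar> ^ K) *
       (\<integral>\<^sup>+x. f (u, (d / c) *\<^sub>R u + (- (a * d - b * c) / c) *\<^sub>R x) \<partial>lborel)"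
      unfolding K_def using False f' D by (intro nn_integral_lborel_affine) measurable
    also have "\<bar>- (a * d - b * c) / c\<bar> = 1 / \<bar>c\<bar>" using det by (simp only: abs_divide abs_minus_cancel)
    finally show ?thesis
      by (simp only: minus_divide_left[symmetric] scaleR_minus_left add_uminus_conv_diff)
  qed
  have "(\<integral>\<^sup>+x. \<integral>\<^sup>+y. f (x, y) \<partial>lborel \<partial>lborel)
    = ennreal ((1 / \<bar>c\<bar>) ^ K) * (\<integral>\<^sup>+u. \<integral>\<^sup>+x. ?g u x \<partial>lborel \<partial>lborel)"
    unfolding 2 using f' by (subst nn_integral_cmult) measurable
  also have "(\<integral>\<^sup>+u. \<integral>\<^sup>+x. ?g u x \<partial>lborel \<partial>lborel) = (\<integral>\<^sup>+x. \<integral>\<^sup>+u. ?g u x \<partial>lborel \<partial>lborel)"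
    using f' by (intro lborel_pair.Fubini') measurable
  also have "\<dots> = ennreal (\<bar>c\<bar> ^ K) * (\<integral>\<^sup>+x. \<integral>\<^sup>+y. f (a *\<^sub>R x + c *\<^sub>R y, b *\<^sub>R x + d *\<^sub>R y) \<partial>lborel \<partial>lborel)"
    unfolding 1 using f' by (subst nn_integral_cmult) measurable
  finally show ?thesis
    using False by (simp add: mult.assoc[symmetric] ennreal_mult[symmetric] power_mult_distrib[symmetric])
qed

definition vec2 :: "real \<Rightarrow> real \<Rightarrow> real^2" where
  "vec2 x y = (\<chi> i. if i = 1 then x else y)"

lemma vec2_nth [simp]: "vec2 x y $ 1 = x" "vec2 x y $ 2 = y"
  by (auto simp: vec2_def)

lemma vec2_eq: "vec2 x y = x *\<^sub>R axis 1 1 + y *\<^sub>R axis 2 1"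
  by (simp add: vec_eq_iff forall_2 axis_def)

lemma vec2_measurable [measurable]: "(\<lambda>(x, y). vec2 x y) \<in> borel_measurable (borel \<Otimes>\<^sub>M borel)"
  unfolding vec2_eq by measurable

lemma Basis_real2: "(Basis :: (real^2) set) = {axis 1 1, axis 2 1}"
  by (auto simp: Basis_vec_def exhaust_2 UNIV_2)

lemma lborel_vec2: "distr (lborel \<Otimes>\<^sub>M lborel) borel (\<lambda>(x, y). vec2 x y) = lborel"
proof (rule lborel_eqI[symmetric])
  fix l u :: "real^2"
  assume lu: "\<And>b. b \<in> Basis \<Longrightarrow> l \<bullet> b \<le> u \<bullet> b"
  have ne: "axis 1 (1::real) \<noteq> (axis 2 1 :: real^2)" by (simp add: axis_eq_axis)
  have 1: "l $ 1 \<le> u $ 1" "l $ 2 \<le> u $ 2"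
    using lu[of "axis 1 1"] lu[of "axis 2 1"] by (auto simp: Basis_real2 inner_axis)
  have "(\<lambda>(x, y). vec2 x y) -` box l u \<inter> space (lborel \<Otimes>\<^sub>M lborel) = {l$1<..<u$1} \<times> {l$2<..<u$2}"
    by (auto simp: space_pair_measure mem_box_cart forall_2)
  then have "emeasure (distr (lborel \<Otimes>\<^sub>M lborel) borel (\<lambda>(x, y). vec2 x y)) (box l u)
    = ennreal ((u$1 - l$1) * (u$2 - l$2))"
    using 1 by (subst emeasure_distr) (auto simp: lborel.emeasure_pair_measure_Times ennreal_mult)
  also have "(u$1 - l$1) * (u$2 - l$2) = (\<Prod>b\<in>Basis. (u - l) \<bullet> b)"
    using ne by (simp add: Basis_real2 inner_axis)
  finally show "emeasure (distr (lborel \<Otimes>\<^sub>M lborel) borel (\<lambda>(x, y). vec2 x y)) (box l u)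
    = (\<Prod>b\<in>Basis. (u - l) \<bullet> b)" .
qed simp

lemma nn_integral_vec2:
  fixes f :: "real^2 \<Rightarrow> ennreal"
  assumes [measurable]: "f \<in> borel_measurable borel"
  shows "(\<integral>\<^sup>+z. f z \<partial>lborel) = (\<integral>\<^sup>+x. \<integral>\<^sup>+y. f (vec2 x y) \<partial>lborel \<partial>lborel)"
proof -
  have "(\<integral>\<^sup>+z. f z \<partial>lborel) = (\<integral>\<^sup>+z. f z \<partial>distr (lborel \<Otimes>\<^sub>M lborel) borel (\<lambda>(x, y). vec2 x y))"
    by (simp only: lborel_vec2)
  also have "\<dots> = (\<integral>\<^sup>+p. f (case p of (x, y) \<Rightarrow> vec2 x y) \<partial>(lborel \<Otimes>\<^sub>M lborel))"
    by (subst nn_integral_distr) auto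
  also have "\<dots> = (\<integral>\<^sup>+x. \<integral>\<^sup>+y. f (vec2 x y) \<partial>lborel \<partial>lborel)"
    by (subst lborel.nn_integral_fst[symmetric]) auto
  finally show ?thesis .
qed

section \<open>The right action of the modular group preserves Haar measure\<close>

definition det2 :: "real^2 \<Rightarrow> real^2 \<Rightarrow> real" where
  "det2 x y = x $ 1 * y $ 2 - x $ 2 * y $ 1"

lemma inner_real2: "x \<bullet> y = x $ 1 * y $ 1 + x $ 2 * (y::real^2) $ 2"
  by (simp add: inner_vec_def sum_2)

lemma norm_real2_sq: "(norm (x::real^2))\<^sup>2 = (x $ 1)\<^sup>2 + (x $ 2)\<^sup>2"
  by (simp only: power2_norm_eq_inner inner_real2) (simp only: power2_eq_square)

lemma perp2_nth [simp]: "perp2 x $ 1 = - (x $ 2)" "perp2 x $ 2 = x $ 1"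
  by (simp_all add: perp2_def)

lemma perp2_vec2: "perp2 x = vec2 (- (x $ 2)) (x $ 1)"
  by (simp add: vec_eq_iff forall_2)

lemma det2_lincomb:
  "det2 (a *\<^sub>R v + c *\<^sub>R y) (b *\<^sub>R v + d *\<^sub>R y) = (a * d - b * c) * det2 v y"
  by (simp add: det2_def algebra_simps)

lemma det2_scaleR: "det2 (r *\<^sub>R v) (s *\<^sub>R y) = r * s * det2 v y"
  by (simp add: det2_def algebra_simps)

lemma real2_decompose:
  assumes "v \<noteq> 0"
  shows "y = (det2 v y / (norm v)\<^sup>2) *\<^sub>R perp2 v + (v \<bullet> y / (norm v)\<^sup>2) *\<^sub>R v"
proof -
  have nz: "(v $ 1)\<^sup>2 + (v $ 2)\<^sup>2 \<noteq> 0" using assms norm_real2_sq[of v] by auto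
  have "y $ 1 * ((v $ 1)\<^sup>2 + (v $ 2)\<^sup>2) = - det2 v y * v $ 2 + (v \<bullet> y) * v $ 1"
    "y $ 2 * ((v $ 1)\<^sup>2 + (v $ 2)\<^sup>2) = det2 v y * v $ 1 + (v \<bullet> y) * v $ 2"
    by (simp_all add: det2_def inner_real2 algebra_simps power2_eq_square)
  then have "y $ 1 = (- det2 v y * v $ 2 + (v \<bullet> y) * v $ 1) / ((v $ 1)\<^sup>2 + (v $ 2)\<^sup>2)"
    "y $ 2 = (det2 v y * v $ 1 + (v \<bullet> y) * v $ 2) / ((v $ 1)\<^sup>2 + (v $ 2)\<^sup>2)"
    using nz by (simp_all only: eq_divide_eq not_False_eq_True if_True)
  then show ?thesis
    by (simp add: vec_eq_iff forall_2 norm_real2_sq add_divide_distrib diff_divide_distrib)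
qed

text \<open>Given the first column, a second column making determinant 1 is determined by its
  component along \<open>v\<close>. Hence an action on matrices can be described by storing only
  that component.\<close>

lemma sl2_col2_eqI:
  assumes "det2 v y = 1"
  shows "sl2_col2 v (v \<bullet> y / (norm v)\<^sup>2) = y"
proof -
  have "v \<noteq> 0" using assms by (auto simp: det2_def)
  from real2_decompose[OF this, of y] show ?thesis by (simp add: sl2_col2_def assms)
qed

lemma det2_sl2_col2:
  assumes "v \<noteq> 0" shows "det2 v (sl2_col2 v t) = 1"
proof -
  have nz: "(v $ 1)\<^sup>2 + (v $ 2)\<^sup>2 \<noteq> 0" using assms norm_real2_sq[of v] by auto
  have "det2 v (sl2_col2 v t) = ((v $ 1)\<^sup>2 + (v $ 2)\<^sup>2) / (norm v)\<^sup>2"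
    by (simp add: det2_def sl2_col2_def algebra_simps power2_eq_square add_divide_distrib)
  then show ?thesis using nz by (simp add: norm_real2_sq)
qed

lemma inner_sl2_col2:
  assumes "v \<noteq> 0" shows "v \<bullet> sl2_col2 v t / (norm v)\<^sup>2 = t"
proof -
  have "v \<bullet> sl2_col2 v t = t * (norm v)\<^sup>2"
    by (simp add: sl2_col2_def inner_add_right power2_norm_eq_inner) (simp add: inner_real2)
  then show ?thesis using assms by simp
qed

lemma borel_measurable_nth_real2 [measurable]: "(\<lambda>x::real^2. x $ i) \<in> borel_measurable borel"
  by (intro borel_measurable_continuous_onI continuous_intros)

lemma borel_measurable_vec2 [measurable (raw)]:
  assumes [measurable]: "f \<in> borel_measurable M" "g \<in> borel_measurable M"
  shows "(\<lambda>x. vec2 (f x) (g x)) \<in> borel_measurable M"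
  unfolding vec2_eq by measurable

lemma borel_measurable_perp2 [measurable]: "perp2 \<in> borel_measurable borel"
  unfolding perp2_vec2[abs_def] by measurable

lemma borel_measurable_det2 [measurable (raw)]:
  assumes [measurable]: "f \<in> borel_measurable M" "g \<in> borel_measurable M"
  shows "(\<lambda>x. det2 (f x) (g x)) \<in> borel_measurable M"
  unfolding det2_def by measurable

lemma borel_measurable_sl2_col2 [measurable (raw)]:
  assumes [measurable]: "f \<in> borel_measurable M" "g \<in> borel_measurable M"
  shows "(\<lambda>x. sl2_col2 (f x) (g x)) \<in> borel_measurable M"
  unfolding sl2_col2_def by measurable

text \<open>The vectors \<open>perp2 v / (norm v)\<^sup>2\<close> and \<open>v\<close> are
  orthogonal with lengths of product 1, so they span a unit area. The coordinate \<open>s\<close> is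
  the determinant of \<open>v\<close> and the point.\<close>

lemma nn_integral_perp2_frame:
  fixes f :: "real^2 \<Rightarrow> ennreal"
  assumes [measurable]: "f \<in> borel_measurable borel" and v: "v \<noteq> 0"
  shows "(\<integral>\<^sup>+y. f y \<partial>lborel) =
    (\<integral>\<^sup>+s. \<integral>\<^sup>+t. f ((s / (norm v)\<^sup>2) *\<^sub>R perp2 v + t *\<^sub>R v) \<partial>lborel \<partial>lborel)"
proof -
  define N where "N = (norm v)\<^sup>2"
  have N: "N \<noteq> 0" "N = (v $ 1)\<^sup>2 + (v $ 2)\<^sup>2" using v by (simp add: N_def, simp only: N_def norm_real2_sq)
  \<comment> \<open>The frame lists the perpendicular vector first and so reverses orientation; this
    is why the substitution rule asks only for a determinant of modulus 1.\<close>
  have d: "(- (v $ 2) / N) * v $ 2 - (v $ 1 / N) * v $ 1 = - 1"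
    using N(1) by (simp add: field_simps) (simp add: N(2) power2_eq_square)
  have "(\<integral>\<^sup>+y. f y \<partial>lborel) = (\<integral>\<^sup>+x. \<integral>\<^sup>+y. f (vec2 x y) \<partial>lborel \<partial>lborel)"
    by (rule nn_integral_vec2) simp
  also have "\<dots> = (\<integral>\<^sup>+x. \<integral>\<^sup>+y. (\<lambda>(x, y). f (vec2 x y)) (x, y) \<partial>lborel \<partial>lborel)"
    by simp
  also have "\<dots> = (\<integral>\<^sup>+s. \<integral>\<^sup>+t. (\<lambda>(x, y). f (vec2 x y))
      ((- (v $ 2) / N) *\<^sub>R s + (v $ 1) *\<^sub>R t, (v $ 1 / N) *\<^sub>R s + (v $ 2) *\<^sub>R t) \<partial>lborel \<partial>lborel)"
    using d by (intro nn_integral_unimodular[symmetric]) (auto simp: borel_prod[symmetric])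
  also have "\<dots> = (\<integral>\<^sup>+s. \<integral>\<^sup>+t. f ((s / N) *\<^sub>R perp2 v + t *\<^sub>R v) \<partial>lborel \<partial>lborel)"
  proof -
    have "vec2 ((- (v $ 2) / N) *\<^sub>R s + (v $ 1) *\<^sub>R t) ((v $ 1 / N) *\<^sub>R s + (v $ 2) *\<^sub>R t)
      = (s / N) *\<^sub>R perp2 v + t *\<^sub>R v" for s t
      by (simp add: vec_eq_iff forall_2 mult.commute)
    then show ?thesis by simp
  qed
  finally show ?thesis by (simp add: N_def)
qed

text \<open>The matrix with columns \<open>v\<close> and \<open>y\<close>, divided by the square
  root of its determinant, in the coordinates (first column, t). The coordinate t needs no rescaling
  because the quotient is unchanged when both columns are scaled alike.\<close>

definition sl2_coords :: "real^2 \<Rightarrow> real^2 \<Rightarrow> (real^2) \<times> real" where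
  "sl2_coords v y = ((1 / sqrt (det2 v y)) *\<^sub>R v, v \<bullet> y / (norm v)\<^sup>2)"

lemma borel_measurable_sl2_coords [measurable (raw)]:
  assumes [measurable]: "f \<in> borel_measurable M" "g \<in> borel_measurable M"
  shows "(\<lambda>x. sl2_coords (f x) (g x)) \<in> borel_measurable M"
  unfolding sl2_coords_def by measurable

lemma AE_real2_nonzero: "AE v in (lborel :: (real^2) measure). v \<noteq> 0"
  by (rule AE_lborel_singleton)

text \<open>In the frame of \<open>v\<close> the determinant becomes the variable \<open>s\<close>.
  Replacing \<open>v\<close> by \<open>v / sqrt s\<close> in the plane costs a factor
  \<open>s\<close>, which the weight \<open>1 / det2 v y\<close> removes. What remains is the
  integral of 1 over the window \<open>{1..2}\<close>, chosen of length 1 and away from 0.\<close>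

lemma nn_integral_sl2_coords:
  fixes f :: "(real^2) \<times> real \<Rightarrow> ennreal"
  assumes f [measurable]: "f \<in> borel_measurable borel"
  shows "(\<integral>\<^sup>+v. \<integral>\<^sup>+y. indicator {1..2} (det2 v y) * ennreal (1 / det2 v y) * f (sl2_coords v y) \<partial>lborel \<partial>lborel)
    = (\<integral>\<^sup>+p. f p \<partial>lborel)"
proof -
  have f' [measurable]: "f \<in> borel_measurable (borel \<Otimes>\<^sub>M borel)" using f by (simp add: borel_prod)
  let ?J = "\<integral>\<^sup>+v. \<integral>\<^sup>+t. f (v, t) \<partial>lborel \<partial>lborel"
  let ?w = "\<lambda>s::real. indicator {1..2} s * ennreal (1 / s) :: ennreal"
  have 1: "(\<integral>\<^sup>+y. indicator {1..2} (det2 v y) * ennreal (1 / det2 v y) * f (sl2_coords v y) \<partial>lborel)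
    = (\<integral>\<^sup>+s. ?w s * (\<integral>\<^sup>+t. f ((1 / sqrt s) *\<^sub>R v, t) \<partial>lborel) \<partial>lborel)" if v: "v \<noteq> 0" for v
  proof -
    have a: "det2 v ((s / (norm v)\<^sup>2) *\<^sub>R perp2 v + t *\<^sub>R v) = s" for s t
    proof -
      have "(s / (norm v)\<^sup>2) *\<^sub>R perp2 v + t *\<^sub>R v = t *\<^sub>R v + s *\<^sub>R sl2_col2 v 0"
        by (simp add: sl2_col2_def)
      then show ?thesis using det2_lincomb[of 1 v 0 "sl2_col2 v 0" t s] det2_sl2_col2[OF v]
        by (simp add: add.commute)
    qed
    have b: "v \<bullet> ((s / (norm v)\<^sup>2) *\<^sub>R perp2 v + t *\<^sub>R v) / (norm v)\<^sup>2 = t" for s t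
    proof -
      have "v \<bullet> perp2 v = 0" by (simp add: inner_real2)
      then show ?thesis using v by (simp add: inner_add_right power2_norm_eq_inner)
    qed
    have "(\<integral>\<^sup>+y. indicator {1..2} (det2 v y) * ennreal (1 / det2 v y) * f (sl2_coords v y) \<partial>lborel)
      = (\<integral>\<^sup>+s. \<integral>\<^sup>+t. ?w s * f ((1 / sqrt s) *\<^sub>R v, t) \<partial>lborel \<partial>lborel)"
      by (subst nn_integral_perp2_frame[OF _ v]) (simp_all only: a b sl2_coords_def, measurable)
    also have "\<dots> = (\<integral>\<^sup>+s. ?w s * (\<integral>\<^sup>+t. f ((1 / sqrt s) *\<^sub>R v, t) \<partial>lborel) \<partial>lborel)"
      by (intro nn_integral_cong nn_integral_cmult) measurable
    finally show ?thesis .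
  qed
  have 2: "?w s * (\<integral>\<^sup>+v. \<integral>\<^sup>+t. f ((1 / sqrt s) *\<^sub>R v, t) \<partial>lborel \<partial>lborel) = indicator {1..2} s * ?J" for s :: real
  proof (cases "s \<in> {1..2}")
    case True
    have "?J = ennreal (\<bar>1 / sqrt s\<bar> ^ DIM(real^2)) *
      (\<integral>\<^sup>+v. \<integral>\<^sup>+t. f (0 + (1 / sqrt s) *\<^sub>R v, t) \<partial>lborel \<partial>lborel)"
      using True by (intro nn_integral_lborel_affine) auto
    also have "\<bar>1 / sqrt s\<bar> ^ DIM(real^2) = 1 / s"
      using True by (simp add: power_divide)
    finally show ?thesis using True by simp
  qed simp
  have "(\<integral>\<^sup>+v. \<integral>\<^sup>+y. indicator {1..2} (det2 v y) * ennreal (1 / det2 v y) * f (sl2_coords v y) \<partial>lborel \<partial>lborel)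
    = (\<integral>\<^sup>+v. \<integral>\<^sup>+s. ?w s * (\<integral>\<^sup>+t. f ((1 / sqrt s) *\<^sub>R v, t) \<partial>lborel) \<partial>lborel \<partial>lborel)"
    using AE_real2_nonzero by (intro nn_integral_cong_AE) (auto simp: 1)
  also have "\<dots> = (\<integral>\<^sup>+s. \<integral>\<^sup>+v. ?w s * (\<integral>\<^sup>+t. f ((1 / sqrt s) *\<^sub>R v, t) \<partial>lborel) \<partial>lborel \<partial>lborel)"
    by (intro lborel_pair.Fubini') measurable
  also have "\<dots> = (\<integral>\<^sup>+s. indicator {1..2} (s::real) * ?J \<partial>lborel)"
    by (subst nn_integral_cmult) (simp_all only: 2, measurable)
  also have "\<dots> = ?J" by (simp add: nn_integral_multc)
  also have "\<dots> = (\<integral>\<^sup>+p. f p \<partial>(lborel \<Otimes>\<^sub>M lborel))"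
    by (rule lborel.nn_integral_fst) simp
  finally show ?thesis by (simp add: lborel_prod)
qed

definition SL2Z :: "(int \<times> int \<times> int \<times> int) set" where
  "SL2Z = {(a, b, c, d). a * d - b * c = 1}"

text \<open>Right multiplication by the integer matrix with rows (a, b) and (c, d); the last
  component reads off t from the new columns \<open>u\<close> and \<open>y\<close>.\<close>

definition act :: "int \<times> int \<times> int \<times> int \<Rightarrow> (real^2) \<times> real \<Rightarrow> (real^2) \<times> real" where
  "act g p = (case g of (a, b, c, d) \<Rightarrow>
     let w = sl2_col2 (fst p) (snd p);
         u = of_int a *\<^sub>R fst p + of_int c *\<^sub>R w;
         y = of_int b *\<^sub>R fst p + of_int d *\<^sub>R w
     in (u, u \<bullet> y / (norm u)\<^sup>2))"

lemma borel_measurable_act [measurable]: "act g \<in> borel_measurable borel"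
proof -
  have "act (a, b, c, d) \<in> borel_measurable (borel \<Otimes>\<^sub>M borel)" for a b c d
    unfolding act_def Let_def prod.case by measurable
  then show ?thesis by (cases g) (auto simp: borel_prod)
qed

text \<open>Scalars commute with right multiplication, and the determinant, which fixes the scalar,
  is the same before and after.\<close>

lemma act_sl2_coords:
  assumes g: "(a, b, c, d) \<in> SL2Z" and "det2 v y > 0"
  shows "act (a, b, c, d) (sl2_coords v y) =
    sl2_coords (of_int a *\<^sub>R v + of_int c *\<^sub>R y) (of_int b *\<^sub>R v + of_int d *\<^sub>R y)"
proof -
  define r where "r = 1 / sqrt (det2 v y)"
  have r: "r \<noteq> 0" "r * r * det2 v y = 1" using assms(2) by (auto simp: r_def)
  have "real_of_int (a * d - b * c) = 1" using g by (simp add: SL2Z_def)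
  then have dt: "det2 (of_int a *\<^sub>R v + of_int c *\<^sub>R y) (of_int b *\<^sub>R v + of_int d *\<^sub>R y) = det2 v y"
    unfolding det2_lincomb by simp
  have rr: "(r *\<^sub>R x) \<bullet> (r *\<^sub>R z) / (norm (r *\<^sub>R x))\<^sup>2 = x \<bullet> z / (norm x)\<^sup>2" for x z :: "real^2"
    using r(1) by (simp add: power_mult_distrib) (simp add: power2_eq_square)
  have w: "sl2_col2 (r *\<^sub>R v) (v \<bullet> y / (norm v)\<^sup>2) = r *\<^sub>R y"
    using sl2_col2_eqI[of "r *\<^sub>R v" "r *\<^sub>R y"] r(2) unfolding rr det2_scaleR by simp
  have e: "of_int m *\<^sub>R r *\<^sub>R v + of_int n *\<^sub>R r *\<^sub>R y = r *\<^sub>R (of_int m *\<^sub>R v + of_int n *\<^sub>R y)" for m n :: int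
    by (simp only: scaleR_add_right scaleR_scaleR mult.commute)
  show ?thesis
    by (simp only: act_def sl2_coords_def prod.case Let_def fst_conv snd_conv dt r_def[symmetric] w e rr)
qed

text \<open>Lifted to all matrices, the action is a unimodular linear substitution in the pair of
  columns; window and weight depend on the determinant alone and so do not change.\<close>

lemma nn_integral_act:
  assumes g: "g \<in> SL2Z" and f [measurable]: "f \<in> borel_measurable borel"
  shows "(\<integral>\<^sup>+p. f (act g p) \<partial>lborel) = (\<integral>\<^sup>+p. f p \<partial>lborel)"
proof -
  obtain a b c d where gd: "g = (a, b, c, d)" by (cases g)
  have "real_of_int (a * d - b * c) = 1" using g by (simp add: SL2Z_def gd)
  then have ad: "of_int a * of_int d - of_int b * of_int c = (1::real)" by simp
  let ?F = "\<lambda>(v, y). indicator {1..2} (det2 v y) * ennreal (1 / det2 v y) * f (sl2_coords v y)"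
  have "(\<integral>\<^sup>+p. f (act g p) \<partial>lborel) = (\<integral>\<^sup>+v. \<integral>\<^sup>+y. indicator {1..2} (det2 v y) * ennreal (1 / det2 v y)
      * f (act g (sl2_coords v y)) \<partial>lborel \<partial>lborel)"
    by (rule nn_integral_sl2_coords[symmetric]) measurable
  also have "\<dots> = (\<integral>\<^sup>+v. \<integral>\<^sup>+y. ?F (of_int a *\<^sub>R v + of_int c *\<^sub>R y, of_int b *\<^sub>R v + of_int d *\<^sub>R y) \<partial>lborel \<partial>lborel)"
    using g by (intro nn_integral_cong) (auto simp: det2_lincomb ad gd act_sl2_coords split: split_indicator)
  also have "\<dots> = (\<integral>\<^sup>+v. \<integral>\<^sup>+y. ?F (v, y) \<partial>lborel \<partial>lborel)"
    using ad by (intro nn_integral_unimodular) (auto simp: borel_prod[symmetric])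
  also have "\<dots> = (\<integral>\<^sup>+p. f p \<partial>lborel)"
    using nn_integral_sl2_coords[OF f] by simp
  finally show ?thesis .
qed

section \<open>Gauss reduction\<close>

fun mmul :: "int \<times> int \<times> int \<times> int \<Rightarrow> int \<times> int \<times> int \<times> int \<Rightarrow> int \<times> int \<times> int \<times> int" where
  "mmul (a, b, c, d) (a', b', c', d') = (a * a' + b * c', a * b' + b * d', c * a' + d * c', c * b' + d * d')"

fun minv :: "int \<times> int \<times> int \<times> int \<Rightarrow> int \<times> int \<times> int \<times> int" where
  "minv (a, b, c, d) = (d, - b, - c, a)"

lemma mmul_SL2Z: "g \<in> SL2Z \<Longrightarrow> h \<in> SL2Z \<Longrightarrow> mmul g h \<in> SL2Z"
proof (cases g, cases h)
  fix a b c d a' b' c' d'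
  assume g: "g = (a, b, c, d)" "h = (a', b', c', d')" "g \<in> SL2Z" "h \<in> SL2Z"
  have "(a * a' + b * c') * (c * b' + d * d') - (a * b' + b * d') * (c * a' + d * c')
     = (a * d - b * c) * (a' * d' - b' * c')" by (simp add: algebra_simps)
  then show ?thesis using g by (simp add: SL2Z_def)
qed

lemma minv_SL2Z: "g \<in> SL2Z \<Longrightarrow> minv g \<in> SL2Z"
  by (cases g) (auto simp: SL2Z_def algebra_simps)

lemma minv_minv [simp]: "minv (minv g) = g"
  by (cases g) auto

lemma mmul_minv_right: "g \<in> SL2Z \<Longrightarrow> mmul g (minv g) = (1, 0, 0, 1)"
  by (cases g) (auto simp: SL2Z_def algebra_simps)

lemma mmul_minv_left_cancel: "g \<in> SL2Z \<Longrightarrow> mmul g (mmul (minv g) h) = h"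
proof (cases g, cases h)
  fix a b c d a' b' c' d'
  assume g: "g = (a, b, c, d)" "h = (a', b', c', d')" "g \<in> SL2Z"
  have 1: "a * d - b * c = 1" using g by (simp add: SL2Z_def)
  have "a * (d * x + - b * y) + b * (- c * x + a * y) = (a * d - b * c) * x"
    "c * (d * x + - b * y) + d * (- c * x + a * y) = (a * d - b * c) * y" for x y
    by (simp_all add: algebra_simps)
  then show ?thesis using g 1 by simp
qed

lemma bij_minv: "bij_betw minv SL2Z SL2Z"
  by (rule bij_betw_byWitness[where f' = minv]) (simp_all add: image_subset_iff minv_SL2Z)

lemma countable_SL2Z: "countable SL2Z"
  by (rule countable_subset[OF subset_UNIV]) simp

lemma act_cols:
  fixes t :: real
  assumes "(a, b, c, d) \<in> SL2Z" "v \<noteq> 0"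
  defines "w \<equiv> sl2_col2 v t"
  shows "fst (act (a, b, c, d) (v, t)) = of_int a *\<^sub>R v + of_int c *\<^sub>R w"
    and "sl2_col2 (fst (act (a, b, c, d) (v, t))) (snd (act (a, b, c, d) (v, t))) =
        of_int b *\<^sub>R v + of_int d *\<^sub>R w"
    and "fst (act (a, b, c, d) (v, t)) \<noteq> 0"
proof -
  have "real_of_int (a * d - b * c) = 1" using assms(1) by (simp add: SL2Z_def)
  then have 1: "det2 (of_int a *\<^sub>R v + of_int c *\<^sub>R w) (of_int b *\<^sub>R v + of_int d *\<^sub>R w) = 1"
    unfolding det2_lincomb w_def using det2_sl2_col2[OF assms(2)] by simp
  have "of_int a *\<^sub>R v + of_int c *\<^sub>R w \<noteq> 0"
  proof
    assume "of_int a *\<^sub>R v + of_int c *\<^sub>R w = 0"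
    with 1 have "det2 0 (of_int b *\<^sub>R v + of_int d *\<^sub>R w) = 1" by simp
    then show False by (simp add: det2_def)
  qed
  then show "fst (act (a, b, c, d) (v, t)) \<noteq> 0"
    by (simp add: act_def Let_def w_def)
  show "fst (act (a, b, c, d) (v, t)) = of_int a *\<^sub>R v + of_int c *\<^sub>R w"
    by (simp add: act_def Let_def w_def)
  show "sl2_col2 (fst (act (a, b, c, d) (v, t))) (snd (act (a, b, c, d) (v, t))) =
        of_int b *\<^sub>R v + of_int d *\<^sub>R w"
    using sl2_col2_eqI[OF 1] by (simp add: act_def Let_def w_def)
qed

lemma fst_act_nz: "g \<in> SL2Z \<Longrightarrow> fst p \<noteq> 0 \<Longrightarrow> fst (act g p) \<noteq> 0"
  by (cases g; cases p) (simp add: act_cols(3))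

text \<open>This fails for a zero first column: there \<open>sl2_col2\<close> is zero as well and
  \<open>act\<close> returns (0, 0). Hence the condition on \<open>fst p\<close>, discharged almost
  everywhere.\<close>

lemma act_one: "fst p \<noteq> 0 \<Longrightarrow> act (1, 0, 0, 1) p = p"
  by (cases p) (simp add: act_def Let_def inner_sl2_col2)

text \<open>It is a right action, so the matrix applied first stands on the left of the
  product.\<close>

lemma act_act:
  assumes "g \<in> SL2Z" "h \<in> SL2Z" "fst p \<noteq> 0"
  shows "act h (act g p) = act (mmul g h) p"
proof -
  obtain a b c d where g: "g = (a, b, c, d)" by (cases g)
  obtain a' b' c' d' where h: "h = (a', b', c', d')" by (cases h)
  obtain v t where p: "p = (v, t)" by (cases p)
  note A = act_cols[of a b c d v t]
  have e: "of_int x *\<^sub>R (of_int a *\<^sub>R v + of_int c *\<^sub>R w) + of_int y *\<^sub>R (of_int b *\<^sub>R v + of_int d *\<^sub>R w)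
    = of_int (a * x + b * y) *\<^sub>R v + of_int (c * x + d * y) *\<^sub>R w" for x y w
    by (simp add: algebra_simps)
  show ?thesis
    unfolding act_def[of h] act_def[of "mmul g h"] using assms A
    by (simp add: g h p Let_def e del: of_int_add of_int_mult)
qed

lemma act_minv: "g \<in> SL2Z \<Longrightarrow> fst p \<noteq> 0 \<Longrightarrow> act (minv g) (act g p) = p"
  by (simp add: act_act minv_SL2Z mmul_minv_right act_one)

text \<open>Multiplying further by the unipotent matrix with rows (1, k) and (0, 1) adds
  \<open>k\<close> times the first column to the second. This translates t by
  \<open>k\<close>.\<close>

lemma act_shift:
  assumes "(a, b, c, d) \<in> SL2Z" "fst p \<noteq> 0"
  shows "(a, b + k * a, c, d + k * c) \<in> SL2Z"
    and "act (a, b + k * a, c, d + k * c) p =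
       (fst (act (a, b, c, d) p), snd (act (a, b, c, d) p) + of_int k)"
proof -
  show 1: "(a, b + k * a, c, d + k * c) \<in> SL2Z" using assms(1) by (simp add: SL2Z_def algebra_simps)
  obtain v t where p: "p = (v, t)" by (cases p)
  define u where "u = of_int a *\<^sub>R v + of_int c *\<^sub>R sl2_col2 v t"
  have u: "u \<noteq> 0" using act_cols(1,3)[OF assms(1)] assms(2) by (simp add: u_def p)
  have e: "of_int (b + k * a) *\<^sub>R v + of_int (d + k * c) *\<^sub>R sl2_col2 v t =
     (of_int b *\<^sub>R v + of_int d *\<^sub>R sl2_col2 v t) + of_int k *\<^sub>R u"
    by (simp add: u_def algebra_simps)
  show "act (a, b + k * a, c, d + k * c) p =
       (fst (act (a, b, c, d) p), snd (act (a, b, c, d) p) + of_int k)"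
    using u unfolding act_def Let_def prod.case p fst_conv snd_conv e u_def[symmetric]
    by (simp add: inner_add_right add_divide_distrib power2_norm_eq_inner)
qed

section \<open>Minima of reduced binary quadratic forms and uniqueness of reduction\<close>

text \<open>A reduced form has minimum \<open>A\<close>: it is at least \<open>A\<close> times
  \<open>m\<^sup>2 - \<bar>m * n\<bar> + n\<^sup>2\<close>, a positive integer because
  \<open>2 * \<bar>m * n\<bar>\<close> is at most \<open>m\<^sup>2 + n\<^sup>2\<close>.\<close>

lemma int_quadratic_form_ge:
  fixes A B C :: real and m n :: int
  assumes "\<bar>2 * B\<bar> \<le> A" "A \<le> C" "(m, n) \<noteq> (0, 0)"
  shows "A \<le> (of_int m)\<^sup>2 * A + 2 * of_int m * of_int n * B + (of_int n)\<^sup>2 * C"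
proof -
  have A: "0 \<le> A" using assms(1) by linarith
  have "1 \<le> m\<^sup>2 - \<bar>m * n\<bar> + n\<^sup>2"
  proof -
    have "0 \<le> (\<bar>m\<bar> - \<bar>n\<bar>)\<^sup>2" by simp
    then have "2 * \<bar>m * n\<bar> \<le> m\<^sup>2 + n\<^sup>2" by (simp add: power2_diff abs_mult)
    moreover have "0 < m\<^sup>2 + n\<^sup>2" using assms(3) by (simp add: sum_power2_gt_zero_iff)
    ultimately show ?thesis by linarith
  qed
  then have "real_of_int 1 \<le> of_int (m\<^sup>2 - \<bar>m * n\<bar> + n\<^sup>2)" by (simp only: of_int_le_iff)
  then have "1 * A \<le> ((of_int m)\<^sup>2 - \<bar>of_int m * of_int n\<bar> + (of_int n)\<^sup>2) * A"
    using A by (intro mult_right_mono) auto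
  moreover have "(of_int n)\<^sup>2 * A \<le> (of_int n)\<^sup>2 * C" using assms(2) by (intro mult_left_mono) auto
  moreover have "- (2 * of_int m * of_int n * B) \<le> \<bar>of_int m * of_int n\<bar> * A"
  proof -
    have "- (2 * of_int m * of_int n * B) \<le> \<bar>(of_int m * of_int n) * (2 * B)\<bar>" by linarith
    also have "\<dots> = \<bar>of_int m * of_int n\<bar> * \<bar>2 * B\<bar>" by (simp only: abs_mult)
    also have "\<dots> \<le> \<bar>of_int m * of_int n\<bar> * A" using assms(1) by (intro mult_left_mono) auto
    finally show ?thesis .
  qed
  ultimately show ?thesis by (simp add: algebra_simps)
qed

lemma int_quadratic_form_gt:
  fixes A B C :: real and m n :: int
  assumes "\<bar>2 * B\<bar> \<le> A" "A < C" "n \<noteq> 0"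
  shows "A < (of_int m)\<^sup>2 * A + 2 * of_int m * of_int n * B + (of_int n)\<^sup>2 * C"
proof -
  have "A \<le> (of_int m)\<^sup>2 * A + 2 * of_int m * of_int n * B + (of_int n)\<^sup>2 * A"
    using assms by (intro int_quadratic_form_ge) auto
  moreover have "(of_int n)\<^sup>2 * A < (of_int n)\<^sup>2 * C" using assms by (intro mult_strict_left_mono) auto
  ultimately show ?thesis by linarith
qed

lemma norm_lincomb_sq:
  fixes u y :: "real^2"
  shows "(norm (p *\<^sub>R u + q *\<^sub>R y))\<^sup>2 = p\<^sup>2 * (norm u)\<^sup>2 + 2 * p * q * (u \<bullet> y) + q\<^sup>2 * (norm y)\<^sup>2"
  unfolding power2_norm_eq_inner
  by (simp add: inner_commute power2_eq_square algebra_simps)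

text \<open>This says that the Gram form of the two columns is reduced in the sense of Gauss: |2B|
  \<le> A \<le> C.\<close>

lemma fund_dom_inner:
  assumes "(v, t) \<in> fund_dom"
  shows "\<bar>2 * (v \<bullet> sl2_col2 v t)\<bar> \<le> (norm v)\<^sup>2" "(norm v)\<^sup>2 \<le> (norm (sl2_col2 v t))\<^sup>2"
proof -
  have v: "v \<noteq> 0" "\<bar>t\<bar> \<le> 1/2" "norm v \<le> norm (sl2_col2 v t)" using assms by (auto simp: fund_dom_def)
  have "v \<bullet> sl2_col2 v t = t * (norm v)\<^sup>2" using inner_sl2_col2[OF v(1), of t] v(1) by (simp add: field_simps)
  then have "\<bar>2 * (v \<bullet> sl2_col2 v t)\<bar> = (2 * \<bar>t\<bar>) * (norm v)\<^sup>2" by (simp add: abs_mult)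
  also have "\<dots> \<le> 1 * (norm v)\<^sup>2" using v(2) by (intro mult_right_mono) auto
  finally show "\<bar>2 * (v \<bullet> sl2_col2 v t)\<bar> \<le> (norm v)\<^sup>2" by simp
  show "(norm v)\<^sup>2 \<le> (norm (sl2_col2 v t))\<^sup>2" using v(3) by (intro power_mono) auto
qed

lemma fund_dom_shortest:
  assumes "(v, t) \<in> fund_dom" "(m, n) \<noteq> (0, 0)"
  shows "norm v \<le> norm (of_int m *\<^sub>R v + of_int n *\<^sub>R sl2_col2 v t)"
proof -
  have "(norm v)\<^sup>2 \<le> (norm (of_int m *\<^sub>R v + of_int n *\<^sub>R sl2_col2 v t))\<^sup>2"
    unfolding norm_lincomb_sq using fund_dom_inner[OF assms(1)] assms(2)
    by (intro int_quadratic_form_ge)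
  then show ?thesis by (simp add: power2_le_iff_abs_le)
qed

text \<open>Making all inequalities strict removes the points where reduction is ambiguous beyond
  sign.\<close>

definition fund_int :: "((real^2) \<times> real) set" where
  "fund_int = {(v, t). v \<noteq> 0 \<and> \<bar>t\<bar> < 1/2 \<and> norm v < norm (sl2_col2 v t)}"

lemma fund_int_subset: "fund_int \<subseteq> fund_dom"
  by (auto simp: fund_int_def fund_dom_def)

lemma fund_int_shortest:
  assumes "(v, t) \<in> fund_int" "n \<noteq> 0"
  shows "norm v < norm (of_int m *\<^sub>R v + of_int n *\<^sub>R sl2_col2 v t)"
proof -
  have F: "(v, t) \<in> fund_dom" using assms(1) fund_int_subset by auto
  have "(norm v)\<^sup>2 < (norm (sl2_col2 v t))\<^sup>2" using assms(1) by (intro power_strict_mono) (auto simp: fund_int_def)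
  then have "(norm v)\<^sup>2 < (norm (of_int m *\<^sub>R v + of_int n *\<^sub>R sl2_col2 v t))\<^sup>2"
    unfolding norm_lincomb_sq using fund_dom_inner[OF F] assms(2)
    by (intro int_quadratic_form_gt)
  then show ?thesis by (rule power2_less_imp_less) simp
qed

text \<open>The old first column is a nonzero combination of the new reduced columns, so the new
  first column is no longer than it. For an interior point only multiples of the first column are
  that short, so \<open>c = 0\<close>. Then \<open>a = d\<close> is a sign and t moves by the
  integer \<open>a * b\<close>, which must vanish.\<close>

lemma act_fund_int_unique:
  assumes g: "g \<in> SL2Z" and p: "p \<in> fund_int" and gp: "act g p \<in> fund_dom"
  shows "g = (1, 0, 0, 1) \<or> g = (- 1, 0, 0, - 1)"
proof -
  obtain a b c d where gd: "g = (a, b, c, d)" by (cases g)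
  obtain v t where pd: "p = (v, t)" by (cases p)
  define w where "w = sl2_col2 v t"
  define u where "u = fst (act g p)"
  define s where "s = snd (act g p)"
  have g': "(a, b, c, d) \<in> SL2Z" "a * d - b * c = 1" using g gd by (auto simp: SL2Z_def)
  have v: "v \<noteq> 0" "\<bar>t\<bar> < 1/2" using p pd by (auto simp: fund_int_def)
  have cols: "u = of_int a *\<^sub>R v + of_int c *\<^sub>R w" "sl2_col2 u s = of_int b *\<^sub>R v + of_int d *\<^sub>R w"
    using act_cols(1,2)[OF g'(1) v(1), of t] by (auto simp: u_def s_def w_def gd pd)
  have us: "(u, s) \<in> fund_dom" using gp by (simp add: u_def s_def)
  \<comment> \<open>The inverse matrix, applied to the new columns.\<close>
  have "of_int d *\<^sub>R u + of_int (- c) *\<^sub>R sl2_col2 u s = of_int (a * d - b * c) *\<^sub>R v"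
    unfolding cols(2) unfolding cols(1) by (simp add: algebra_simps)
  moreover have "(d, - c) \<noteq> (0, 0)" using g'(2) by auto
  ultimately have "norm u \<le> norm v"
    using fund_dom_shortest[OF us, of d "- c"] g'(2) by auto
  then have c: "c = 0"
    using fund_int_shortest[of v t c a] p by (auto simp: pd cols(1) w_def)
  have ad: "a * d = 1" using g' c by simp
  then have "(a = 1 \<and> d = 1) \<or> (a = -1 \<and> d = -1)" by (simp add: zmult_eq_1_iff)
  then have a2: "a = d" "a * a = 1" "of_int a * of_int a = (1::real)" by auto
  have "s = u \<bullet> sl2_col2 u s / (norm u)\<^sup>2"
    using inner_sl2_col2[of u s] us by (auto simp: fund_dom_def)
  also have "\<dots> = of_int (a * b) + t"
  proof -
    have "v \<bullet> w = t * (norm v)\<^sup>2"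
      using inner_sl2_col2[OF v(1), of t] v(1) by (simp add: field_simps w_def)
    then have "u \<bullet> sl2_col2 u s = (of_int a * of_int b + of_int a * of_int a * t) * (norm v)\<^sup>2"
      unfolding cols(2) unfolding cols(1) by (simp add: c a2(1) algebra_simps power2_norm_eq_inner)
    moreover have "(norm u)\<^sup>2 = (of_int a * of_int a) * (norm v)\<^sup>2"
      by (simp add: cols c power_mult_distrib) (simp add: power2_eq_square)
    ultimately show ?thesis using v(1) by (simp add: a2(3))
  qed
  finally have "\<bar>of_int (a * b) + t\<bar> \<le> 1/2" using us by (auto simp: fund_dom_def)
  \<comment> \<open>One of the two bounds by 1/2 is strict, which excludes a shift by exactly
    1.\<close>
  then have "\<bar>real_of_int (a * b)\<bar> < 1" using v(2) by linarith
  then have "a * b = 0" by linarith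
  then have "b = 0" using ad by auto
  then show ?thesis using \<open>(a = 1 \<and> d = 1) \<or> _\<close> c gd by auto
qed

lemma abs_det2_le: "\<bar>det2 x y\<bar> \<le> norm x * norm y"
proof -
  have "norm (perp2 x) = norm x"
    by (rule power2_eq_imp_eq) (auto simp: norm_real2_sq)
  moreover have "det2 x y = perp2 x \<bullet> y" by (simp add: det2_def inner_real2)
  ultimately show ?thesis using Cauchy_Schwarz_ineq2[of "perp2 x" y] by simp
qed

text \<open>By Cramer's rule each coefficient is the determinant of the vector with one basis
  column. So a bounded set meets the lattice in finitely many points.\<close>

lemma lattice_coeff_bounds:
  assumes v: "v \<noteq> 0"
  shows "\<bar>of_int c\<bar> \<le> norm v * norm (of_int a *\<^sub>R v + of_int c *\<^sub>R sl2_col2 v t)"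
    and "\<bar>of_int a\<bar> \<le> norm (of_int a *\<^sub>R v + of_int c *\<^sub>R sl2_col2 v t) * norm (sl2_col2 v t)"
proof -
  let ?w = "sl2_col2 v t"
  let ?x = "of_int a *\<^sub>R v + of_int c *\<^sub>R ?w"
  have "det2 v ?x = of_int c" "det2 ?x ?w = of_int a"
    using det2_lincomb[of 1 v 0 ?w "of_int a" "of_int c"] det2_lincomb[of "of_int a" v "of_int c" ?w 0 1]
      det2_sl2_col2[OF v] by simp_all
  then show "\<bar>of_int c\<bar> \<le> norm v * norm ?x" "\<bar>of_int a\<bar> \<le> norm ?x * norm ?w"
    using abs_det2_le[of v ?x] abs_det2_le[of ?x ?w] by simp_all
qed

text \<open>A shortest nonzero lattice vector has coprime coefficients and, by Bezout, is the first
  column of some matrix. A shift by an integer brings t into [-1/2, 1/2], and the second column, a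
  nonzero lattice vector, cannot be shorter than the first.\<close>

lemma fund_dom_covers:
  assumes v: "v \<noteq> 0"
  shows "\<exists>g\<in>SL2Z. act g (v, t) \<in> fund_dom"
proof -
  define w where "w = sl2_col2 v t"
  define L where "L = (\<lambda>(a, c). norm (of_int a *\<^sub>R v + of_int c *\<^sub>R w))"
  define K where "K = {x :: int \<times> int. x \<noteq> (0, 0) \<and> L x \<le> norm v}"
  have cc: "\<bar>of_int c\<bar> \<le> norm v * L (a, c)" and aa: "\<bar>of_int a\<bar> \<le> L (a, c) * norm w" for a c
    unfolding L_def w_def prod.case by (rule lattice_coeff_bounds[OF v])+
  have L0: "L x > 0" if "x \<noteq> (0, 0)" for x
  proof -
    obtain a c where x: "x = (a, c)" by (cases x)
    have "L x \<noteq> 0" using that cc[of c a] aa[of a c] by (auto simp: x)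
    moreover have "L x \<ge> 0" by (simp add: x L_def)
    ultimately show ?thesis by simp
  qed
  define M where "M = \<lceil>norm v * norm v\<rceil> + \<lceil>norm v * norm w\<rceil>"
  have "K \<subseteq> {- M..M} \<times> {- M..M}"
  proof
    fix x assume "x \<in> K"
    then obtain a c where x: "x = (a, c)" "L (a, c) \<le> norm v" by (cases x) (auto simp: K_def)
    have "\<bar>real_of_int c\<bar> \<le> norm v * norm v"
      using cc[of c a] x(2) mult_left_mono[OF x(2), of "norm v"] by simp
    moreover have "\<bar>real_of_int a\<bar> \<le> norm v * norm w"
      using aa[of a c] x(2) mult_right_mono[OF x(2), of "norm w"] by simp
    moreover have "0 \<le> norm v * norm v" "0 \<le> norm v * norm w" by auto
    ultimately have "\<bar>c\<bar> \<le> M" "\<bar>a\<bar> \<le> M" unfolding M_def by linarith+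
    then show "x \<in> {- M..M} \<times> {- M..M}" by (auto simp: x)
  qed
  then have "finite K" by (rule finite_subset) simp
  moreover have "(1, 0) \<in> K" by (simp add: K_def L_def)
  ultimately obtain x where x: "x \<in> K" "\<And>y. y \<in> K \<Longrightarrow> L x \<le> L y"
    using ex_is_arg_min_if_finite[of K L] by (auto simp: is_arg_min_linorder)
  \<comment> \<open>Pairs outside \<open>K\<close> give vectors longer than \<open>v\<close>, so the
    minimum over the finite set \<open>K\<close> is global.\<close>
  have min: "L x \<le> L y" if "y \<noteq> (0, 0)" for y
    using x that by (cases "y \<in> K") (auto simp: K_def)
  obtain a c where ac: "x = (a, c)" by (cases x)
  have nz: "(a, c) \<noteq> (0, 0)" using x(1) by (simp add: K_def ac)
  have "gcd a c = 1"
  proof (rule ccontr)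
    assume ne: "gcd a c \<noteq> 1"
    define h where "h = gcd a c"
    have "h > 0" using nz by (auto simp: h_def)
    then have h: "h \<ge> 2" using ne unfolding h_def by linarith
    have e: "a = h * (a div h)" "c = h * (c div h)" by (auto simp: h_def)
    have nz': "(a div h, c div h) \<noteq> (0, 0)" using nz e by auto
    have "L x = norm (of_int h *\<^sub>R (of_int (a div h) *\<^sub>R v + of_int (c div h) *\<^sub>R w))"
      unfolding ac L_def prod.case by (subst e(1), subst e(2)) (simp only: of_int_mult scaleR_add_right scaleR_scaleR)
    also have "\<dots> = of_int h * L (a div h, c div h)" using h by (simp add: L_def)
    also have "\<dots> \<ge> 2 * L (a div h, c div h)" using h L0[OF nz'] by (intro mult_right_mono) auto
    finally have "2 * L (a div h, c div h) \<le> L (a div h, c div h)" using min[OF nz'] by simp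
    then show False using L0[OF nz'] by simp
  qed
  then obtain d b' where "d * a + b' * c = 1" using bezout_int[of a c] by auto
  then have g: "(a, - b', c, d) \<in> SL2Z" by (simp add: SL2Z_def algebra_simps)
  define k where "k = - round (snd (act (a, - b', c, d) (v, t)))"
  define g' where "g' = (a, - b' + k * a, c, d + k * c)"
  have g': "g' \<in> SL2Z" and ag: "act g' (v, t) =
     (fst (act (a, - b', c, d) (v, t)), snd (act (a, - b', c, d) (v, t)) + of_int k)"
    unfolding g'_def using act_shift[OF g, of "(v, t)"] v by auto
  have "\<bar>snd (act g' (v, t))\<bar> \<le> 1/2"
    unfolding ag k_def snd_conv using of_int_round_abs_le[of "snd (act (a, - b', c, d) (v, t))"]
    by (simp add: abs_minus_commute)
  moreover have "norm (fst (act g' (v, t))) \<le> norm (sl2_col2 (fst (act g' (v, t))) (snd (act g' (v, t))))"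
  proof -
    have "(- b' + k * a, d + k * c) \<noteq> (0, 0)" using g' by (auto simp: g'_def SL2Z_def)
    from min[OF this] show ?thesis
      using act_cols(1,2)[OF g'[unfolded g'_def] v, of t] by (simp add: g'_def L_def ac w_def)
  qed
  moreover have "fst (act g' (v, t)) \<noteq> 0" using fst_act_nz[OF g'] v by simp
  ultimately have "act g' (v, t) \<in> fund_dom" by (cases "act g' (v, t)") (auto simp: fund_dom_def)
  then show ?thesis using g' by blast
qed

section \<open>Unfolding\<close>

lemma borel_measurable_nn_integral_count_space:
  fixes f :: "'i \<Rightarrow> 'a \<Rightarrow> ennreal"
  assumes "countable I" and [measurable]: "\<And>i. i \<in> I \<Longrightarrow> f i \<in> borel_measurable M"
  shows "(\<lambda>x. \<integral>\<^sup>+i. f i x \<partial>count_space I) \<in> borel_measurable M"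
proof (cases "finite I")
  case True then show ?thesis by (simp add: nn_integral_count_space_finite)
next
  case False
  then have ne: "I \<noteq> {}" by auto
  note * = bij_betw_from_nat_into[OF \<open>countable I\<close> False]
  have "(\<integral>\<^sup>+i. f i x \<partial>count_space I) = (\<Sum>n. f (from_nat_into I n) x)" for x
    by (simp add: nn_integral_bij_count_space[symmetric, OF *] nn_integral_count_space_nat)
  then show ?thesis using from_nat_into[OF ne] by simp
qed

lemma norm_sl2_col2_sq:
  assumes "v \<noteq> 0"
  shows "(norm (sl2_col2 v t))\<^sup>2 = 1 / (norm v)\<^sup>2 + t\<^sup>2 * (norm v)\<^sup>2"
proof -
  have "norm (perp2 v) = norm v" by (rule power2_eq_imp_eq) (auto simp: norm_real2_sq)
  moreover have "perp2 v \<bullet> v = 0" by (simp add: inner_real2)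
  moreover have "norm v \<noteq> 0" using assms by simp
  ultimately show ?thesis
    unfolding sl2_col2_def norm_lincomb_sq by (simp add: power2_eq_square divide_simps)
qed

lemma borel_fund_dom [measurable]: "fund_dom \<in> sets borel"
proof -
  have "fund_dom = {p \<in> space (borel \<Otimes>\<^sub>M borel). fst p \<noteq> 0 \<and> \<bar>snd p\<bar> \<le> 1/2 \<and> norm (fst p) \<le> norm (sl2_col2 (fst p) (snd p))}"
    by (auto simp: fund_dom_def space_pair_measure)
  also have "\<dots> \<in> sets (borel \<Otimes>\<^sub>M borel)" by measurable
  finally show ?thesis by (simp only: borel_prod)
qed

lemma borel_fund_int [measurable]: "fund_int \<in> sets borel"
proof -
  have "fund_int = {p \<in> space (borel \<Otimes>\<^sub>M borel). fst p \<noteq> 0 \<and> \<bar>snd p\<bar> < 1/2 \<and> norm (fst p) < norm (sl2_col2 (fst p) (snd p))}"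
    by (auto simp: fund_int_def space_pair_measure)
  also have "\<dots> \<in> sets (borel \<Otimes>\<^sub>M borel)" by measurable
  finally show ?thesis by (simp only: borel_prod)
qed

lemma AE_lborel_pairI:
  fixes P :: "'a::euclidean_space \<times> 'b::euclidean_space \<Rightarrow> bool"
  assumes "{p. P p} \<in> sets borel" "AE x in lborel. AE y in lborel. P (x, y)"
  shows "AE p in lborel. P p"
proof -
  have "{p \<in> space (lborel \<Otimes>\<^sub>M lborel). P p} \<in> sets (lborel \<Otimes>\<^sub>M lborel)"
    unfolding lborel_prod using assms(1) by simp
  from lborel_pair.AE_pair_measure[OF this assms(2)] show ?thesis by (simp only: lborel_prod)
qed

text \<open>For each nonzero \<open>v\<close> the boundary meets the t-line in at most four
  points.\<close>

lemma AE_not_boundary: "AE p in lborel. p \<notin> fund_dom - fund_int"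
proof (rule AE_lborel_pairI)
  have "{p. p \<notin> fund_dom - fund_int} = UNIV - (fund_dom - fund_int)" by auto
  also have "\<dots> \<in> sets borel" by measurable
  finally show "{p. p \<notin> fund_dom - fund_int} \<in> sets borel" .
  show "AE v in lborel. AE t in lborel. (v, t) \<notin> fund_dom - fund_int"
  proof (rule AE_mp[OF AE_real2_nonzero], rule AE_I2, rule impI)
    fix v :: "real^2" assume v: "v \<noteq> 0"
    \<comment> \<open>The value of \<open>t\<^sup>2\<close> at which both columns have equal length.
      If it is negative there is no such t, and excluding the two roots is harmless.\<close>
    define c where "c = ((norm v)\<^sup>2 - 1 / (norm v)\<^sup>2) / (norm v)\<^sup>2"
    have "AE t in lborel. t \<noteq> 1/2 \<and> t \<noteq> - (1/2) \<and> t \<noteq> sqrt c \<and> t \<noteq> - sqrt c"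
      by (intro AE_conjI AE_lborel_singleton)
    then show "AE t in lborel. (v, t) \<notin> fund_dom - fund_int"
    proof eventually_elim
      case (elim t)
      have "norm v \<noteq> norm (sl2_col2 v t)"
      proof
        assume "norm v = norm (sl2_col2 v t)"
        then have "(norm v)\<^sup>2 = 1 / (norm v)\<^sup>2 + t\<^sup>2 * (norm v)\<^sup>2" using norm_sl2_col2_sq[OF v, of t] by simp
        then have "t\<^sup>2 * (norm v)\<^sup>2 = (norm v)\<^sup>2 - 1 / (norm v)\<^sup>2" by linarith
        then have "t\<^sup>2 = c" using v by (simp only: c_def eq_divide_eq) simp
        then have "sqrt c = \<bar>t\<bar>" by auto
        then show False using elim by (auto simp: abs_if split: if_splits)
      qed
      moreover have "\<bar>t\<bar> \<noteq> 1/2" using elim by (auto simp: abs_if)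
      ultimately show ?case by (auto simp: fund_dom_def fund_int_def)
    qed
  qed
qed

lemma AE_act:
  assumes "g \<in> SL2Z" "{p. P p} \<in> sets borel" "AE p in lborel. P p"
  shows "AE p in lborel. P (act g p)"
proof -
  let ?f = "indicator (- {p. P p}) :: _ \<Rightarrow> ennreal"
  have [measurable]: "- {p. P p} \<in> sets borel" using assms(2) by auto
  have "(\<integral>\<^sup>+p. ?f (act g p) \<partial>lborel) = (\<integral>\<^sup>+p. ?f p \<partial>lborel)"
    by (rule nn_integral_act) (use assms(1) in auto)
  also have "\<dots> = 0" using assms(3) by (subst nn_integral_0_iff_AE) auto
  finally have "AE p in lborel. ?f (act g p) = 0" by (subst (asm) nn_integral_0_iff_AE) auto
  then show ?thesis by eventually_elim (auto split: split_indicator_asm)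
qed

lemma AE_fst_nonzero: "AE p in (lborel :: ((real^2) \<times> real) measure). fst p \<noteq> 0"
proof (rule AE_lborel_pairI)
  have "{p :: (real^2) \<times> real. fst p \<noteq> 0} = {p \<in> space (borel \<Otimes>\<^sub>M borel). fst p \<noteq> 0}"
    by (auto simp: space_pair_measure)
  also have "\<dots> \<in> sets (borel \<Otimes>\<^sub>M borel)" by measurable
  finally show "{p :: (real^2) \<times> real. fst p \<noteq> 0} \<in> sets borel" by (simp only: borel_prod)
qed (use AE_real2_nonzero in auto)

text \<open>The group is countable, so almost every orbit avoids the boundary altogether. If
  \<open>g\<close> brings \<open>p\<close> into the domain, it brings it into the interior, and
  uniqueness there leaves only \<open>g\<close> and its negative; -I maps (v, t) to (-v, t) and
  preserves the domain.\<close>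

lemma AE_fund_dom_count:
  "AE p in lborel. (\<integral>\<^sup>+g. indicator fund_dom (act g p) \<partial>count_space SL2Z) = (2::ennreal)"
proof -
  have "AE p in lborel. \<forall>g\<in>SL2Z. act g p \<notin> fund_dom - fund_int"
  proof (rule AE_ball_countable'[OF _ countable_SL2Z])
    fix g assume "g \<in> SL2Z"
    moreover have "{p. p \<notin> fund_dom - fund_int} = UNIV - (fund_dom - fund_int)" by auto
    then have "{p. p \<notin> fund_dom - fund_int} \<in> sets borel" by simp
    ultimately show "AE p in lborel. act g p \<notin> fund_dom - fund_int"
      using AE_not_boundary by (intro AE_act)
  qed
  then show ?thesis using AE_fst_nonzero
  proof eventually_elim
    case (elim p)
    obtain g where g: "g \<in> SL2Z" "act g p \<in> fund_dom"
      using fund_dom_covers[of "fst p" "snd p"] elim(2) by auto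
    then have gi: "act g p \<in> fund_int" using elim(1) by auto
    let ?m = "(- 1, 0, 0, - 1) :: int \<times> int \<times> int \<times> int"
    have m: "?m \<in> SL2Z" by (simp add: SL2Z_def)
    have act_m: "act ?m q = (- fst q, snd q)" if "fst q \<noteq> 0" for q
      using that inner_sl2_col2[of "fst q" "snd q"] by (simp add: act_def Let_def)
    have col_m: "sl2_col2 (- v) t = - sl2_col2 v t" for v t
      by (simp add: sl2_col2_def vec_eq_iff forall_2)
    have eq: "{h \<in> SL2Z. act h p \<in> fund_dom} = {g, mmul g ?m}"
    proof (intro equalityI subsetI)
      fix h assume "h \<in> {h \<in> SL2Z. act h p \<in> fund_dom}"
      then have h: "h \<in> SL2Z" "act h p \<in> fund_dom" by auto
      define k where "k = mmul (minv g) h"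
      have k: "k \<in> SL2Z" using mmul_SL2Z[OF minv_SL2Z[OF g(1)] h(1)] by (simp add: k_def)
      have hk: "h = mmul g k" using mmul_minv_left_cancel[OF g(1)] by (simp add: k_def)
      have "act k (act g p) \<in> fund_dom" using act_act[OF g(1) k elim(2)] h hk by simp
      from act_fund_int_unique[OF k gi this] show "h \<in> {g, mmul g ?m}"
        unfolding hk by (cases g) auto
    next
      fix h assume h: "h \<in> {g, mmul g ?m}"
      have "act ?m (act g p) \<in> fund_dom"
        using act_m[OF fst_act_nz[OF g(1) elim(2)]] g(2) by (cases "act g p") (auto simp: fund_dom_def col_m)
      then show "h \<in> {h \<in> SL2Z. act h p \<in> fund_dom}"
        using h g mmul_SL2Z[OF g(1) m] act_act[OF g(1) m elim(2)] by auto
    qed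
    have ne: "g \<noteq> mmul g ?m" using g(1) by (cases g) (auto simp: SL2Z_def)
    have "(\<integral>\<^sup>+h. indicator fund_dom (act h p) \<partial>count_space SL2Z) =
       (\<integral>\<^sup>+h. indicator {h \<in> SL2Z. act h p \<in> fund_dom} h \<partial>count_space SL2Z)"
      by (intro nn_integral_cong) (auto split: split_indicator)
    also have "\<dots> = emeasure (count_space SL2Z) {h \<in> SL2Z. act h p \<in> fund_dom}"
      by (subst nn_integral_indicator) auto
    also have "\<dots> = of_nat (card {g, mmul g ?m})"
      using g mmul_SL2Z[OF g(1) m] unfolding eq by (subst emeasure_count_space_finite) auto
    also have "\<dots> = 2" using ne by simp
    finally show ?case .
  qed
qed

text \<open>Invariance moves \<open>act g\<close> from \<open>G\<close> to its inverse on the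
  indicator, inversion permutes the group, and the remaining sum is the orbit count 2.\<close>

lemma nn_integral_unfold:
  assumes [measurable]: "G \<in> borel_measurable borel"
  shows "(\<integral>\<^sup>+p. indicator fund_dom p * (\<integral>\<^sup>+g. G (act g p) \<partial>count_space SL2Z) \<partial>lborel) = 2 * (\<integral>\<^sup>+p. G p \<partial>lborel)"
proof -
  have "(\<integral>\<^sup>+p. indicator fund_dom p * (\<integral>\<^sup>+g. G (act g p) \<partial>count_space SL2Z) \<partial>lborel)
      = (\<integral>\<^sup>+p. \<integral>\<^sup>+g. indicator fund_dom p * G (act g p) \<partial>count_space SL2Z \<partial>lborel)"
    by (simp add: nn_integral_cmult)
  also have "\<dots> = (\<integral>\<^sup>+g. \<integral>\<^sup>+p. indicator fund_dom p * G (act g p) \<partial>lborel \<partial>count_space SL2Z)"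
    by (intro nn_integral_count_space_nn_integral countable_SL2Z) measurable
  also have "\<dots> = (\<integral>\<^sup>+g. \<integral>\<^sup>+p. indicator fund_dom (act (minv g) p) * G p \<partial>lborel \<partial>count_space SL2Z)"
  proof (rule nn_integral_cong)
    fix g assume "g \<in> space (count_space SL2Z)"
    then have g: "g \<in> SL2Z" by simp
    have "(\<integral>\<^sup>+p. indicator fund_dom p * G (act g p) \<partial>lborel) =
       (\<integral>\<^sup>+p. (\<lambda>p. indicator fund_dom (act (minv g) p) * G p) (act g p) \<partial>lborel)"
      using AE_fst_nonzero by (intro nn_integral_cong_AE) (auto simp: act_minv[OF g])
    also have "\<dots> = (\<integral>\<^sup>+p. indicator fund_dom (act (minv g) p) * G p \<partial>lborel)"
      by (intro nn_integral_act g) measurable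
    finally show "(\<integral>\<^sup>+p. indicator fund_dom p * G (act g p) \<partial>lborel) =
       (\<integral>\<^sup>+p. indicator fund_dom (act (minv g) p) * G p \<partial>lborel)" .
  qed
  also have "\<dots> = (\<integral>\<^sup>+g. \<integral>\<^sup>+p. indicator fund_dom (act g p) * G p \<partial>lborel \<partial>count_space SL2Z)"
    by (rule nn_integral_bij_count_space[OF bij_minv])
  also have "\<dots> = (\<integral>\<^sup>+p. \<integral>\<^sup>+g. indicator fund_dom (act g p) * G p \<partial>count_space SL2Z \<partial>lborel)"
    by (intro nn_integral_count_space_nn_integral[symmetric] countable_SL2Z) measurable
  also have "\<dots> = (\<integral>\<^sup>+p. (\<integral>\<^sup>+g. indicator fund_dom (act g p) \<partial>count_space SL2Z) * G p \<partial>lborel)"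
    by (simp add: nn_integral_multc)
  also have "\<dots> = (\<integral>\<^sup>+p. 2 * G p \<partial>lborel)"
    using AE_fund_dom_count by (intro nn_integral_cong_AE) auto
  also have "\<dots> = 2 * (\<integral>\<^sup>+p. G p \<partial>lborel)" by (simp add: nn_integral_cmult)
  finally show ?thesis .
qed

section \<open>Primitive vectors as coprime pairs of coefficients\<close>

definition coprime_pairs :: "(int \<times> int) set" where
  "coprime_pairs = {(a, c). coprime a c}"

text \<open>The primitive Siegel transform, indexed by coefficients: an index set independent of
  \<open>p\<close> makes it a countable sum of measurable functions. Unlike \<open>infsum\<close>,
  which is 0 on families that are not summable, it takes the value infinity on divergent
  sums.\<close>

definition prim_sum :: "(real^2 \<Rightarrow> ennreal) \<Rightarrow> (real^2) \<times> real \<Rightarrow> ennreal" where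
  "prim_sum f p = (\<integral>\<^sup>+x. f (of_int (fst x) *\<^sub>R fst p + of_int (snd x) *\<^sub>R sl2_col2 (fst p) (snd p)) \<partial>count_space coprime_pairs)"

lemma borel_measurable_prim_sum [measurable]:
  assumes [measurable]: "f \<in> borel_measurable borel"
  shows "prim_sum f \<in> borel_measurable borel"
proof -
  have "prim_sum f \<in> borel_measurable (borel \<Otimes>\<^sub>M borel)"
    unfolding prim_sum_def[abs_def]
    by (intro borel_measurable_nn_integral_count_space) (auto intro: countable_subset[OF subset_UNIV])
  then show ?thesis by (simp add: borel_prod)
qed

lemma lattice_coeffs_unique:
  assumes "v \<noteq> 0"
    and "of_int a *\<^sub>R v + of_int c *\<^sub>R sl2_col2 v t = of_int a' *\<^sub>R v + of_int c' *\<^sub>R sl2_col2 v t"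
  shows "a = a' \<and> c = c'"
proof -
  let ?w = "sl2_col2 v t"
  note d = det2_sl2_col2[OF assms(1), of t]
  have "det2 (of_int a *\<^sub>R v + of_int c *\<^sub>R ?w) ?w = of_int a" "det2 v (of_int a *\<^sub>R v + of_int c *\<^sub>R ?w) = of_int c" for a c :: int
    using det2_lincomb[of "of_int a" v "of_int c" ?w 0 1] det2_lincomb[of 1 v 0 ?w "of_int a" "of_int c"] d by simp_all
  then show ?thesis using assms(2) by (metis of_int_eq_iff)
qed

text \<open>Coefficients are unique, so integer divisors of a lattice vector are the common divisors
  of its two coefficients.\<close>

lemma primitive_vectors_sl2_lattice:
  assumes v: "fst p \<noteq> 0"
  shows "bij_betw (\<lambda>x. of_int (fst x) *\<^sub>R fst p + of_int (snd x) *\<^sub>R sl2_col2 (fst p) (snd p))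
     coprime_pairs (primitive_vectors (sl2_lattice p))"
proof -
  define v where "v = fst p"
  define w where "w = sl2_col2 v (snd p)"
  define F where "F = (\<lambda>x. of_int (fst x) *\<^sub>R v + of_int (snd x) *\<^sub>R w)"
  have Finj: "F x = F y \<Longrightarrow> x = y" for x y
    using lattice_coeffs_unique[of v "fst x" "snd x" "snd p" "fst y" "snd y"] assms
    by (auto simp: F_def v_def w_def prod_eq_iff)
  have L: "sl2_lattice p = range F"
    by (auto simp: sl2_lattice_def lattice_of_def F_def v_def w_def image_def)
  have F0: "F (0, 0) = 0" by (simp add: F_def)
  have Fk: "of_int k *\<^sub>R F (a, c) = F (k * a, k * c)" for k a c
    by (simp add: F_def algebra_simps)
  have "F ` coprime_pairs = primitive_vectors (sl2_lattice p)"
  proof (intro equalityI subsetI)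
    fix x assume "x \<in> F ` coprime_pairs"
    then obtain a c where x: "x = F (a, c)" "coprime a c" by (auto simp: coprime_pairs_def)
    have "x \<noteq> 0"
    proof
      assume "x = 0"
      then have "(a, c) = (0, 0)" using x F0 by (metis Finj)
      then show False using x by simp
    qed
    moreover have "\<bar>k\<bar> = 1" if "x = of_int k *\<^sub>R F y" for k y
    proof -
      have "(a, c) = (k * fst y, k * snd y)"
        using that x Fk[of k "fst y" "snd y"] by (intro Finj) simp
      then have "k dvd a" "k dvd c" by auto
      then show ?thesis using x(2) by (meson coprime_common_divisor_int)
    qed
    ultimately show "x \<in> primitive_vectors (sl2_lattice p)"
      unfolding primitive_vectors_def L using x by auto
  next
    fix x assume x: "x \<in> primitive_vectors (sl2_lattice p)"
    then obtain a c where ac: "x = F (a, c)" by (auto simp: primitive_vectors_def L)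
    have "x \<noteq> 0" using x by (auto simp: primitive_vectors_def)
    have "x = of_int (gcd a c) *\<^sub>R F (a div gcd a c, c div gcd a c)"
      unfolding Fk ac by simp
    then have "\<bar>gcd a c\<bar> = 1" using x unfolding primitive_vectors_def L by blast
    then have "coprime a c" by (simp add: coprime_iff_gcd_eq_1)
    then show "x \<in> F ` coprime_pairs" by (auto simp: coprime_pairs_def ac)
  qed
  then show ?thesis using Finj unfolding F_def v_def w_def by (intro bij_betw_imageI inj_onI)
qed

lemma prim_sum_eq:
  assumes "fst p \<noteq> 0"
  shows "prim_sum f p = (\<integral>\<^sup>+x. f x \<partial>count_space (primitive_vectors (sl2_lattice p)))"
  unfolding prim_sum_def by (rule nn_integral_bij_count_space[OF primitive_vectors_sl2_lattice[OF assms]])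

lemma sl2_lattice_act_subset:
  assumes "g \<in> SL2Z" "fst p \<noteq> 0"
  shows "sl2_lattice (act g p) \<subseteq> sl2_lattice p"
proof -
  obtain a b c d where g: "g = (a, b, c, d)" by (cases g)
  obtain v t where p: "p = (v, t)" by (cases p)
  have e: "of_int x *\<^sub>R (of_int a *\<^sub>R v + of_int c *\<^sub>R w) + of_int y *\<^sub>R (of_int b *\<^sub>R v + of_int d *\<^sub>R w)
    = of_int (a * x + b * y) *\<^sub>R v + of_int (c * x + d * y) *\<^sub>R w" for x y w
    by (simp add: algebra_simps)
  show ?thesis
    using act_cols(1,2)[of a b c d v t] assms unfolding sl2_lattice_def lattice_of_def g p
    by (auto simp: e simp del: of_int_add of_int_mult)
qed

lemma sl2_lattice_act:
  assumes "g \<in> SL2Z" "fst p \<noteq> 0"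
  shows "sl2_lattice (act g p) = sl2_lattice p"
  using sl2_lattice_act_subset[OF assms] sl2_lattice_act_subset[OF minv_SL2Z[OF assms(1)], of "act g p"]
    act_minv[OF assms] fst_act_nz[OF assms] by auto

lemma prim_sum_act: "g \<in> SL2Z \<Longrightarrow> fst p \<noteq> 0 \<Longrightarrow> prim_sum f (act g p) = prim_sum f p"
  by (simp add: prim_sum_eq fst_act_nz sl2_lattice_act)

text \<open>The matrices with a prescribed first column differ by unipotent factors on the right.
  These translate t by the integers, and exactly one translate lies in [0, 1).\<close>

lemma SL2Z_strip_bij:
  assumes p: "fst p \<noteq> 0"
  shows "bij_betw (\<lambda>(a, b, c, d). (a, c)) {g \<in> SL2Z. snd (act g p) \<in> {0..<1}} coprime_pairs"
proof (rule bij_betw_imageI)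
  show "inj_on (\<lambda>(a, b, c, d). (a, c)) {g \<in> SL2Z. snd (act g p) \<in> {0..<1}}"
  proof (rule inj_onI)
    fix g h assume gh: "g \<in> {g \<in> SL2Z. snd (act g p) \<in> {0..<1}}" "h \<in> {g \<in> SL2Z. snd (act g p) \<in> {0..<1}}"
      "(\<lambda>(a, b, c, d). (a, c)) g = (\<lambda>(a, b, c, d). (a, c)) h"
    then obtain a b c d b' d' where e: "g = (a, b, c, d)" "h = (a, b', c, d')"
      by (cases g; cases h) auto
    \<comment> \<open>The multiple of the first column by which the two second columns differ,
      obtained by eliminating with both determinant equations.\<close>
    define k where "k = b * d' - d * b'"
    have S: "(a, b', c, d') \<in> SL2Z" "a * d - b * c = 1" "a * d' - b' * c = 1" using gh e by (auto simp: SL2Z_def)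
    have "b' + k * a = b * (a * d' - b' * c) - b' * (a * d - b * c) + b'"
      "d' + k * c = d * (a * d' - b' * c) - d' * (a * d - b * c) + d'"
      unfolding k_def by (simp_all add: algebra_simps)
    then have bd: "b' + k * a = b" "d' + k * c = d" unfolding S by auto
    have "snd (act g p) = snd (act h p) + of_int k"
      using act_shift(2)[OF S(1) p, of k] by (simp add: e bd)
    then have "\<bar>real_of_int k\<bar> < 1" using gh by auto
    then have "k = 0" by linarith
    then show "g = h" using bd e by simp
  qed
  show "(\<lambda>(a, b, c, d). (a, c)) ` {g \<in> SL2Z. snd (act g p) \<in> {0..<1}} = coprime_pairs"
  proof (intro equalityI subsetI)
    fix x assume "x \<in> (\<lambda>(a, b, c, d). (a, c)) ` {g \<in> SL2Z. snd (act g p) \<in> {0..<1}}"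
    then obtain a b c d where x: "x = (a, c)" "a * d - b * c = 1" by (auto simp: SL2Z_def)
    have "coprime a c"
    proof (rule coprimeI)
      fix k assume "k dvd a" "k dvd c"
      then have "k dvd a * d - b * c" by simp
      then show "is_unit k" using x(2) by simp
    qed
    then show "x \<in> coprime_pairs" by (simp add: x coprime_pairs_def)
  next
    fix x assume "x \<in> coprime_pairs"
    then obtain a c where x: "x = (a, c)" "gcd a c = 1" by (auto simp: coprime_pairs_def)
    then obtain d b' where "d * a + b' * c = 1" using bezout_int[of a c] by auto
    then have g: "(a, - b', c, d) \<in> SL2Z" by (simp add: SL2Z_def algebra_simps)
    define k where "k = - \<lfloor>snd (act (a, - b', c, d) p)\<rfloor>"
    have "snd (act (a, - b' + k * a, c, d + k * c) p) \<in> {0..<1}"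
      using act_shift(2)[OF g p, of k] by (auto simp: k_def) linarith
    then have "(a, - b' + k * a, c, d + k * c) \<in> {g \<in> SL2Z. snd (act g p) \<in> {0..<1}}"
      using act_shift(1)[OF g p, of k] by simp
    then have "(\<lambda>(a, b, c, d). (a, c)) (a, - b' + k * a, c, d + k * c) \<in> (\<lambda>(a, b, c, d). (a, c)) ` {g \<in> SL2Z. snd (act g p) \<in> {0..<1}}"
      by (rule imageI)
    then show "x \<in> (\<lambda>(a, b, c, d). (a, c)) ` {g \<in> SL2Z. snd (act g p) \<in> {0..<1}}"
      by (simp add: x)
  qed
qed

lemma nn_integral_SL2Z_strip:
  assumes p: "fst p \<noteq> 0"
  shows "(\<integral>\<^sup>+g. indicator {0..<1} (snd (act g p)) * f (fst (act g p)) \<partial>count_space SL2Z) = prim_sum f p"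
proof -
  let ?G = "{g \<in> SL2Z. snd (act g p) \<in> {0..<1}}"
  let ?F = "\<lambda>x. f (of_int (fst x) *\<^sub>R fst p + of_int (snd x) *\<^sub>R sl2_col2 (fst p) (snd p))"
  have "(\<integral>\<^sup>+g. indicator {0..<1} (snd (act g p)) * f (fst (act g p)) \<partial>count_space SL2Z)
     = (\<integral>\<^sup>+g. ?F ((\<lambda>(a, b, c, d). (a, c)) g) \<partial>count_space ?G)"
    by (subst (1 2) nn_integral_count_space_indicator; (simp; fail)?; intro nn_integral_cong)
       (auto split: split_indicator simp: act_def Let_def)
  also have "\<dots> = prim_sum f p"
    unfolding prim_sum_def by (rule nn_integral_bij_count_space[OF SL2Z_strip_bij[OF p]])
  finally show ?thesis .
qed

lemma nn_integral_prim_sum_mult: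
  assumes [measurable]: "f \<in> borel_measurable borel" "h \<in> borel_measurable borel"
  shows "(\<integral>\<^sup>+p. indicator fund_dom p * (prim_sum f p * prim_sum h p) \<partial>lborel)
    = 2 * (\<integral>\<^sup>+p. indicator {0..<1} (snd p) * f (fst p) * prim_sum h p \<partial>lborel)"
proof -
  let ?G = "\<lambda>p. indicator {0..<1} (snd p) * f (fst p) * prim_sum h p"
  have [measurable]: "?G \<in> borel_measurable borel"
  proof -
    have "prim_sum h \<in> borel_measurable (borel \<Otimes>\<^sub>M borel)" by (simp add: borel_prod)
    then have "?G \<in> borel_measurable (borel \<Otimes>\<^sub>M borel)" by measurable
    then show ?thesis by (simp add: borel_prod)
  qed
  have *: "(\<integral>\<^sup>+g. ?G (act g p) \<partial>count_space SL2Z) = prim_sum f p * prim_sum h p" if p: "fst p \<noteq> 0" for p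
  proof -
    have "(\<integral>\<^sup>+g. ?G (act g p) \<partial>count_space SL2Z) =
       (\<integral>\<^sup>+g. indicator {0..<1} (snd (act g p)) * f (fst (act g p)) * prim_sum h p \<partial>count_space SL2Z)"
      using p by (intro nn_integral_cong) (simp add: prim_sum_act)
    then show ?thesis by (simp add: nn_integral_multc nn_integral_SL2Z_strip[OF p])
  qed
  have "(\<integral>\<^sup>+p. indicator fund_dom p * (prim_sum f p * prim_sum h p) \<partial>lborel) =
     (\<integral>\<^sup>+p. indicator fund_dom p * (\<integral>\<^sup>+g. ?G (act g p) \<partial>count_space SL2Z) \<partial>lborel)"
    using AE_fst_nonzero by (intro nn_integral_cong_AE) (auto simp: *)
  also have "\<dots> = 2 * (\<integral>\<^sup>+p. ?G p \<partial>lborel)" by (rule nn_integral_unfold) measurable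
  finally show ?thesis .
qed

section \<open>Rogers' formula\<close>

text \<open>Moving the window by one trades \<open>m\<close> for \<open>m + N\<close>, and
  coprimality to \<open>N\<close> is periodic modulo \<open>N\<close>. So the count may be taken
  over 1, ..., N.\<close>

lemma card_coprime_window:
  fixes N m :: int
  assumes "N > 0"
  shows "card {k \<in> {m..<m + N}. coprime k N} = totient (nat N)"
proof -
  define f where "f = (\<lambda>m. card {k \<in> {m..<m + N}. coprime k N})"
  have step: "f (m + 1) = f m" for m
  proof -
    define B where "B = {k \<in> {m + 1..<m + N}. coprime k N}"
    have B: "finite B" "m \<notin> B" "m + N \<notin> B"
      unfolding B_def by (rule finite_subset[of _ "{m + 1..<m + N}"]) auto
    have cop: "coprime (m + N) N \<longleftrightarrow> coprime m N" by (simp add: coprime_iff_gcd_eq_1)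
    have 1: "{k \<in> {m..<m + N}. coprime k N} = (if coprime m N then insert m B else B)"
      using assms by (auto simp: B_def order_le_less)
    have 2: "{k \<in> {m + 1..<m + 1 + N}. coprime k N} = (if coprime m N then insert (m + N) B else B)"
      using assms cop by (auto simp: B_def order_le_less) (smt (verit))+
    show ?thesis unfolding f_def 1 2 using B by simp
  qed
  have "f m = f 1"
  proof (induction m rule: int_induct[where k = 1])
    case (step2 i) then show ?case using step[of "i - 1"] by simp
  qed (simp_all add: step)
  also have "f 1 = card (int ` totatives (nat N))"
  proof -
    have "{k \<in> {1..<1 + N}. coprime k N} = int ` totatives (nat N)"
    proof (intro equalityI subsetI)
      fix k assume "k \<in> {k \<in> {1..<1 + N}. coprime k N}"
      then have "nat k \<in> totatives (nat N)" "k = int (nat k)"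
        using assms by (auto simp: totatives_def simp flip: coprime_int_iff)
      then show "k \<in> int ` totatives (nat N)" by blast
    qed (use assms in \<open>auto simp: totatives_def simp flip: coprime_int_iff\<close>)
    then show ?thesis by (simp add: f_def)
  qed
  also have "\<dots> = totient (nat N)" by (simp add: card_image totient_def)
  finally show ?thesis by (simp add: f_def)
qed

lemma card_coprime_real_window:
  fixes n :: int and x :: real
  assumes "n \<noteq> 0"
  shows "card {k. coprime k n \<and> (x - of_int k) / of_int n \<in> {0..<1}} = totient (nat \<bar>n\<bar>)"
    and "finite {k. coprime k n \<and> (x - of_int k) / of_int n \<in> {0..<1}}"
proof -
  \<comment> \<open>The condition is x - n < k \<le> x for positive \<open>n\<close> and x \<le> k <
    x - n for negative \<open>n\<close>. The closed end changes sides, which accounts for the floor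
    with \<open>+ 1\<close> and for the ceiling.\<close>
  define m where "m = (if n > 0 then \<lfloor>x\<rfloor> - n + 1 else \<lceil>x\<rceil>)"
  have *: "{k. coprime k n \<and> (x - of_int k) / of_int n \<in> {0..<1}} = {k \<in> {m..<m + \<bar>n\<bar>}. coprime k \<bar>n\<bar>}"
  proof (cases "n > 0")
    case True
    then have "(x - of_int k) / of_int n \<in> {0..<1} \<longleftrightarrow> of_int k \<le> x \<and> x < of_int k + of_int n" for k
      by (auto simp: field_simps)
    moreover have "of_int k \<le> x \<and> x < of_int k + of_int n \<longleftrightarrow> k \<in> {m..<m + \<bar>n\<bar>}" for k
      using True by (auto simp: m_def le_floor_iff) (linarith+)
    ultimately show ?thesis using True by auto
  next
    case False
    then have n: "n < 0" using assms by simp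
    then have "(x - of_int k) / of_int n \<in> {0..<1} \<longleftrightarrow> x \<le> of_int k \<and> of_int k + of_int n < x" for k
      by (auto simp: field_simps)
    moreover have "x \<le> of_int k \<and> of_int k + of_int n < x \<longleftrightarrow> k \<in> {m..<m + \<bar>n\<bar>}" for k
      using n by (auto simp: m_def ceiling_le_iff) (linarith+)
    ultimately show ?thesis using n by auto
  qed
  show "finite {k. coprime k n \<and> (x - of_int k) / of_int n \<in> {0..<1}}"
    unfolding * by (rule finite_subset[of _ "{m..<m + \<bar>n\<bar>}"]) auto
  show "card {k. coprime k n \<and> (x - of_int k) / of_int n \<in> {0..<1}} = totient (nat \<bar>n\<bar>)"
    unfolding * using assms by (intro card_coprime_window) simp
qed

text \<open>Under x = n t + k the strip becomes an interval of length |n| starting or ending at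
  \<open>k\<close>. The Jacobian supplies 1/|n|, and the number of admissible \<open>k\<close> at a
  given x supplies the totient.\<close>

lemma nn_integral_coprime_strip:
  fixes h :: "real \<Rightarrow> ennreal"
  assumes [measurable]: "h \<in> borel_measurable borel" and n: "n \<noteq> 0"
  shows "(\<integral>\<^sup>+k. \<integral>\<^sup>+t. indicator {0..<1} t * h (of_int n * t + of_int k) \<partial>lborel \<partial>count_space {k. coprime k n})
    = ennreal (real (totient (nat \<bar>n\<bar>)) / real (nat \<bar>n\<bar>)) * (\<integral>\<^sup>+t. h t \<partial>lborel)"
proof -
  let ?I = "\<lambda>(k::int) (x::real). indicator {0..<1} ((x - of_int k) / of_int n) :: ennreal"
  let ?N = "\<bar>real_of_int n\<bar>"
  have N: "?N > 0" using n by simp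
  have *: "(\<integral>\<^sup>+t. indicator {0..<1} t * h (of_int n * t + of_int k) \<partial>lborel) =
     ennreal (1 / ?N) * (\<integral>\<^sup>+x. ?I k x * h x \<partial>lborel)" for k
  proof -
    have "(\<integral>\<^sup>+x. ?I k x * h x \<partial>lborel) = ennreal ?N *
       (\<integral>\<^sup>+t. ?I k (of_int k + of_int n * t) * h (of_int k + of_int n * t) \<partial>lborel)"
      using n by (intro nn_integral_real_affine) auto
    then show ?thesis using n
      by (simp add: mult.assoc[symmetric] ennreal_mult[symmetric] add.commute)
  qed
  have cnt: "(\<integral>\<^sup>+k. ?I k x \<partial>count_space {k. coprime k n}) = of_nat (totient (nat \<bar>n\<bar>))" for x
  proof -
    let ?A = "{k. coprime k n \<and> (x - of_int k) / of_int n \<in> {0..<1}}"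
    have "(\<integral>\<^sup>+k. ?I k x \<partial>count_space {k. coprime k n}) = (\<integral>\<^sup>+k. indicator ?A k \<partial>count_space {k. coprime k n})"
      by (intro nn_integral_cong) (simp add: indicator_def)
    also have "\<dots> = emeasure (count_space {k. coprime k n}) ?A" by (subst nn_integral_indicator) auto
    also have "\<dots> = of_nat (card ?A)"
      using card_coprime_real_window(2)[OF n, of x] by (subst emeasure_count_space_finite) auto
    finally show ?thesis unfolding card_coprime_real_window(1)[OF n] .
  qed
  have "(\<integral>\<^sup>+k. \<integral>\<^sup>+t. indicator {0..<1} t * h (of_int n * t + of_int k) \<partial>lborel \<partial>count_space {k. coprime k n})
    = ennreal (1 / ?N) * (\<integral>\<^sup>+k. \<integral>\<^sup>+x. ?I k x * h x \<partial>lborel \<partial>count_space {k. coprime k n})"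
    unfolding * by (simp add: nn_integral_cmult)
  also have "(\<integral>\<^sup>+k. \<integral>\<^sup>+x. ?I k x * h x \<partial>lborel \<partial>count_space {k. coprime k n})
    = (\<integral>\<^sup>+x. \<integral>\<^sup>+k. ?I k x * h x \<partial>count_space {k. coprime k n} \<partial>lborel)"
    by (intro nn_integral_count_space_nn_integral[symmetric]) (auto intro: countable_subset[OF subset_UNIV])
  also have "\<dots> = of_nat (totient (nat \<bar>n\<bar>)) * (\<integral>\<^sup>+x. h x \<partial>lborel)"
    by (simp add: nn_integral_multc cnt nn_integral_cmult)
  also have "ennreal (1 / ?N) * (of_nat (totient (nat \<bar>n\<bar>)) * (\<integral>\<^sup>+x. h x \<partial>lborel)) =
     ennreal (real (totient (nat \<bar>n\<bar>)) / real (nat \<bar>n\<bar>)) * (\<integral>\<^sup>+t. h t \<partial>lborel)"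
    by (simp add: mult.assoc[symmetric] ennreal_of_nat_eq_real_of_nat ennreal_mult[symmetric])
  finally show ?thesis .
qed

text \<open>Sorted by second entry; the pairs coprime with second entry 0 have a unit in the
  first.\<close>

lemma nn_integral_coprime_pairs:
  "(\<integral>\<^sup>+x. F x \<partial>count_space coprime_pairs) =
     F (1, 0) + F (- 1, 0) + (\<integral>\<^sup>+n. \<integral>\<^sup>+k. F (k, n) \<partial>count_space {k. coprime k n} \<partial>count_space {n. n \<noteq> 0})"
proof -
  define Q where "Q n = (\<integral>\<^sup>+k. F (k, n) \<partial>count_space {k. coprime k n})" for n
  have *: "(\<integral>\<^sup>+x. g x \<partial>count_space A) = (\<integral>\<^sup>+x. g x * indicator A x \<partial>count_space UNIV)"
    for g :: "'b \<Rightarrow> ennreal" and A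
    by (cases "A = UNIV") (auto intro: nn_integral_count_space_indicator)
  have "(\<integral>\<^sup>+x. F x \<partial>count_space coprime_pairs) = (\<integral>\<^sup>+x. F x * indicator coprime_pairs x \<partial>count_space UNIV)"
    by (rule *)
  also have "\<dots> = (\<integral>\<^sup>+n. \<integral>\<^sup>+k. F (k, n) * indicator coprime_pairs (k, n) \<partial>count_space UNIV \<partial>count_space UNIV)"
    by (rule nn_integral_snd_count_space[symmetric])
  also have "\<dots> = (\<integral>\<^sup>+n. Q n \<partial>count_space UNIV)"
    unfolding Q_def by (subst (3) *) (auto simp: coprime_pairs_def indicator_def intro!: nn_integral_cong)
  also have "\<dots> = (\<integral>\<^sup>+n. Q n * indicator {0} n + Q n * indicator {n. n \<noteq> 0} n \<partial>count_space UNIV)"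
    by (intro nn_integral_cong) (auto split: split_indicator)
  also have "\<dots> = (\<integral>\<^sup>+n. Q n \<partial>count_space {0}) + (\<integral>\<^sup>+n. Q n \<partial>count_space {n. n \<noteq> 0})"
    by (subst nn_integral_add) (auto simp: * [symmetric])
  also have "(\<integral>\<^sup>+n. Q n \<partial>count_space {0}) = Q 0" by (simp add: nn_integral_count_space_finite)
  also have "Q 0 = F (1, 0) + F (- 1, 0)"
  proof -
    have "{k::int. is_unit k} = {1, - 1}" by auto
    then show ?thesis by (simp add: Q_def nn_integral_count_space_finite)
  qed
  finally show ?thesis by (simp add: Q_def)
qed

text \<open>For nonzero \<open>v\<close>, an integral along the line of points whose determinant
  with \<open>v\<close> is \<open>n\<close>. For the indicator of \<open>S\<close> it is the length
  of the set \<open>I_set S n v\<close>.\<close>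

definition line_integral :: "(real^2 \<Rightarrow> ennreal) \<Rightarrow> int \<Rightarrow> real^2 \<Rightarrow> ennreal" where
  "line_integral h n v = (\<integral>\<^sup>+t. h (of_int n *\<^sub>R ((1 / (norm v)\<^sup>2) *\<^sub>R perp2 v) + t *\<^sub>R v) \<partial>lborel)"

lemma borel_measurable_line_integral [measurable]:
  assumes [measurable]: "h \<in> borel_measurable borel"
  shows "line_integral h n \<in> borel_measurable borel"
  unfolding line_integral_def[abs_def] by measurable

lemma nn_integral_strip_prim_sum:
  assumes [measurable]: "h \<in> borel_measurable borel" and v: "v \<noteq> 0"
  shows "(\<integral>\<^sup>+t. indicator {0..<1} t * prim_sum h (v, t) \<partial>lborel) =
    h v + h (- v) + (\<integral>\<^sup>+n. ennreal (real (totient (nat \<bar>n\<bar>)) / real (nat \<bar>n\<bar>)) * line_integral h n v \<partial>count_space {n. n \<noteq> 0})"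
proof -
  define K where "K x t = h (of_int (fst x) *\<^sub>R v + of_int (snd x) *\<^sub>R sl2_col2 v t)" for x t
  have [measurable]: "K x \<in> borel_measurable borel" for x unfolding K_def by measurable
  define F where "F x = (\<integral>\<^sup>+t. indicator {0..<1} t * K x t \<partial>lborel)" for x
  have "(\<integral>\<^sup>+t. indicator {0..<1} t * prim_sum h (v, t) \<partial>lborel) =
     (\<integral>\<^sup>+t. \<integral>\<^sup>+x. indicator {0..<1} t * K x t \<partial>count_space coprime_pairs \<partial>lborel)"
    by (simp add: prim_sum_def K_def nn_integral_cmult)
  also have "\<dots> = (\<integral>\<^sup>+x. F x \<partial>count_space coprime_pairs)"
    unfolding F_def by (intro nn_integral_count_space_nn_integral) (auto intro: countable_subset[OF subset_UNIV])
  also have "\<dots> = F (1, 0) + F (- 1, 0) + (\<integral>\<^sup>+n. \<integral>\<^sup>+k. F (k, n) \<partial>count_space {k. coprime k n} \<partial>count_space {n. n \<noteq> 0})"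
    by (rule nn_integral_coprime_pairs)
  also have "F (1, 0) = h v" by (simp add: F_def K_def nn_integral_multc)
  also have "F (- 1, 0) = h (- v)" by (simp add: F_def K_def nn_integral_multc)
  also have "(\<integral>\<^sup>+n. \<integral>\<^sup>+k. F (k, n) \<partial>count_space {k. coprime k n} \<partial>count_space {n. n \<noteq> 0}) =
    (\<integral>\<^sup>+n. ennreal (real (totient (nat \<bar>n\<bar>)) / real (nat \<bar>n\<bar>)) * line_integral h n v \<partial>count_space {n. n \<noteq> 0})"
  proof (intro nn_integral_cong)
    fix n :: int assume "n \<in> space (count_space {n. n \<noteq> 0})"
    then have n: "n \<noteq> 0" by simp
    define h' where "h' s = h (of_int n *\<^sub>R ((1 / (norm v)\<^sup>2) *\<^sub>R perp2 v) + s *\<^sub>R v)" for s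
    have [measurable]: "h' \<in> borel_measurable borel" unfolding h'_def by measurable
    \<comment> \<open>In k v + n w the multiples of \<open>v\<close> combine to n t + k, while the
      perpendicular part depends on \<open>n\<close> only.\<close>
    have "K (k, n) t = h' (of_int n * t + of_int k)" for k t
      unfolding K_def h'_def sl2_col2_def by (simp add: algebra_simps)
    then have "(\<integral>\<^sup>+k. F (k, n) \<partial>count_space {k. coprime k n}) =
      (\<integral>\<^sup>+k. \<integral>\<^sup>+t. indicator {0..<1} t * h' (of_int n * t + of_int k) \<partial>lborel \<partial>count_space {k. coprime k n})"
      by (simp add: F_def)
    also have "\<dots> = ennreal (real (totient (nat \<bar>n\<bar>)) / real (nat \<bar>n\<bar>)) * (\<integral>\<^sup>+t. h' t \<partial>lborel)"
      by (rule nn_integral_coprime_strip) (use n in auto)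
    finally show "(\<integral>\<^sup>+k. F (k, n) \<partial>count_space {k. coprime k n}) =
      ennreal (real (totient (nat \<bar>n\<bar>)) / real (nat \<bar>n\<bar>)) * line_integral h n v"
      by (simp add: h'_def line_integral_def)
  qed
  finally show ?thesis .
qed

text \<open>Stated for two functions, since the treatment of null sets pairs an indicator with the
  constant 1. It is not yet normalised by the volume of the domain.\<close>

lemma rogers_formula:
  assumes f [measurable]: "f \<in> borel_measurable borel" and h [measurable]: "h \<in> borel_measurable borel"
  shows "(\<integral>\<^sup>+p. indicator fund_dom p * (prim_sum f p * prim_sum h p) \<partial>lborel) =
    2 * ((\<integral>\<^sup>+v. f v * h v \<partial>lborel) + (\<integral>\<^sup>+v. f v * h (- v) \<partial>lborel) +
      (\<integral>\<^sup>+n. ennreal (real (totient (nat \<bar>n\<bar>)) / real (nat \<bar>n\<bar>)) *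
         (\<integral>\<^sup>+v. f v * line_integral h n v \<partial>lborel) \<partial>count_space {n. n \<noteq> 0}))"
proof -
  let ?c = "\<lambda>n::int. ennreal (real (totient (nat \<bar>n\<bar>)) / real (nat \<bar>n\<bar>))"
  have ps [measurable]: "prim_sum h \<in> borel_measurable (borel \<Otimes>\<^sub>M borel)" by (simp add: borel_prod)
  have cI: "countable {n::int. n \<noteq> 0}" by (rule countable_subset[OF subset_UNIV]) simp
  have "(\<integral>\<^sup>+p. indicator {0..<1} (snd p) * f (fst p) * prim_sum h p \<partial>lborel)
    = (\<integral>\<^sup>+p. indicator {0..<1} (snd p) * f (fst p) * prim_sum h p \<partial>(lborel \<Otimes>\<^sub>M lborel))"
    by (simp only: lborel_prod)
  also have "\<dots> = (\<integral>\<^sup>+v. \<integral>\<^sup>+t. f v * (indicator {0..<1} t * prim_sum h (v, t)) \<partial>lborel \<partial>lborel)"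
    by (subst lborel.nn_integral_fst[symmetric]) (auto simp: mult_ac)
  also have "\<dots> = (\<integral>\<^sup>+v. f v * (\<integral>\<^sup>+t. indicator {0..<1} t * prim_sum h (v, t) \<partial>lborel) \<partial>lborel)"
    by (intro nn_integral_cong nn_integral_cmult) measurable
  also have "\<dots> = (\<integral>\<^sup>+v. f v * (h v + h (- v) + (\<integral>\<^sup>+n. ?c n * line_integral h n v \<partial>count_space {n. n \<noteq> 0})) \<partial>lborel)"
    using AE_real2_nonzero by (intro nn_integral_cong_AE) (auto simp: nn_integral_strip_prim_sum)
  also have "\<dots> = (\<integral>\<^sup>+v. f v * h v + f v * h (- v) + (\<integral>\<^sup>+n. ?c n * (f v * line_integral h n v) \<partial>count_space {n. n \<noteq> 0}) \<partial>lborel)"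
    by (intro nn_integral_cong)
       (simp add: distrib_left nn_integral_cmult[symmetric] mult.left_commute)
  also have "\<dots> = (\<integral>\<^sup>+v. f v * h v \<partial>lborel) + (\<integral>\<^sup>+v. f v * h (- v) \<partial>lborel) +
     (\<integral>\<^sup>+v. \<integral>\<^sup>+n. ?c n * (f v * line_integral h n v) \<partial>count_space {n. n \<noteq> 0} \<partial>lborel)"
  proof -
    define G where "G v = (\<integral>\<^sup>+n. ?c n * (f v * line_integral h n v) \<partial>count_space {n. n \<noteq> 0})" for v
    have [measurable]: "G \<in> borel_measurable borel"
      unfolding G_def[abs_def] by (intro borel_measurable_nn_integral_count_space cI) measurable
    show ?thesis unfolding G_def[symmetric] by (simp add: nn_integral_add)
  qed
  also have "(\<integral>\<^sup>+v. \<integral>\<^sup>+n. ?c n * (f v * line_integral h n v) \<partial>count_space {n. n \<noteq> 0} \<partial>lborel)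
    = (\<integral>\<^sup>+n. \<integral>\<^sup>+v. ?c n * (f v * line_integral h n v) \<partial>lborel \<partial>count_space {n. n \<noteq> 0})"
    by (intro nn_integral_count_space_nn_integral cI) measurable
  also have "\<dots> = (\<integral>\<^sup>+n. ?c n * (\<integral>\<^sup>+v. f v * line_integral h n v \<partial>lborel) \<partial>count_space {n. n \<noteq> 0})"
    by (intro nn_integral_cong nn_integral_cmult) measurable
  finally show ?thesis using nn_integral_prim_sum_mult[OF f h] by simp
qed

section \<open>Volume of the reduced domain\<close>

text \<open>With the length of the second column computed by Pythagoras, the comparison of lengths
  reads |v|^4 (1 - t^2) \<le> 1. Each slice is thus a disc without its centre.\<close>

lemma fund_dom_slice:
  assumes v: "v \<noteq> 0" and t: "\<bar>t\<bar> \<le> 1/2"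
  shows "(v, t) \<in> fund_dom \<longleftrightarrow> norm v \<le> 1 / sqrt (sqrt (1 - t\<^sup>2))"
proof -
  have "t\<^sup>2 \<le> (1/2)\<^sup>2" using t by (simp add: power2_le_iff_abs_le)
  then have t1: "1 - t\<^sup>2 > 0" by (simp add: power2_eq_square)
  let ?N = "(norm v)\<^sup>2"
  have N: "?N > 0" using v by simp
  have "(v, t) \<in> fund_dom \<longleftrightarrow> ?N \<le> (norm (sl2_col2 v t))\<^sup>2"
    using v t by (simp add: fund_dom_def power2_le_iff_abs_le)
  also have "\<dots> \<longleftrightarrow> ?N * ?N \<le> ?N * (norm (sl2_col2 v t))\<^sup>2"
    by (simp only: mult_le_cancel_left_pos[OF N])
  also have "\<dots> \<longleftrightarrow> ?N\<^sup>2 * (1 - t\<^sup>2) \<le> 1"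
    unfolding norm_sl2_col2_sq[OF v] using v by (simp add: algebra_simps power2_eq_square)
  also have "\<dots> \<longleftrightarrow> sqrt (sqrt (?N\<^sup>2 * (1 - t\<^sup>2))) \<le> 1" by simp
  also have "sqrt (sqrt (?N\<^sup>2 * (1 - t\<^sup>2))) = norm v * sqrt (sqrt (1 - t\<^sup>2))"
  proof -
    have "sqrt (?N\<^sup>2 * (1 - t\<^sup>2)) = ?N * sqrt (1 - t\<^sup>2)"
      by (simp only: real_sqrt_mult real_sqrt_abs abs_power2)
    then have "sqrt (sqrt (?N\<^sup>2 * (1 - t\<^sup>2))) = sqrt (?N * sqrt (1 - t\<^sup>2))" by (rule arg_cong)
    also have "\<dots> = norm v * sqrt (sqrt (1 - t\<^sup>2))" by (simp add: real_sqrt_mult)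
    finally show ?thesis .
  qed
  also have "\<dots> \<le> 1 \<longleftrightarrow> norm v \<le> 1 / sqrt (sqrt (1 - t\<^sup>2))"
    using t1 by (simp add: pos_le_divide_eq)
  finally show ?thesis .
qed

text \<open>The slice at t has area pi / sqrt (1 - t^2), with antiderivative pi arcsin t. The
  endpoints -1/2 and 1/2 contribute pi/6 each to the arcsine.\<close>

lemma emeasure_fund_dom: "emeasure lborel fund_dom = ennreal (pi\<^sup>2 / 3)"
proof -
  have slice: "(\<integral>\<^sup>+v. indicator fund_dom (v, t) \<partial>lborel) = ennreal (pi / sqrt (1 - t\<^sup>2)) * indicator {-1/2..1/2} t" for t
  proof (cases "\<bar>t\<bar> \<le> 1/2")
    case True
    have "t\<^sup>2 \<le> (1/2)\<^sup>2" using True by (simp add: power2_le_iff_abs_le)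
    then have t1: "1 - t\<^sup>2 > 0" by (simp add: power2_eq_square)
    let ?r = "1 / sqrt (sqrt (1 - t\<^sup>2))"
    have "(\<integral>\<^sup>+v. indicator fund_dom (v, t) \<partial>lborel) = (\<integral>\<^sup>+v. indicator (cball 0 ?r) (v::real^2) \<partial>lborel)"
      using AE_real2_nonzero
      by (intro nn_integral_cong_AE) (auto simp: fund_dom_slice[OF _ True] indicator_def)
    also have "\<dots> = ennreal (pi * ?r ^ 2)"
      using t1 by (simp add: emeasure_cball unit_ball_vol_2)
    also have "pi * ?r ^ 2 = pi / sqrt (1 - t\<^sup>2)" using t1 by (simp add: power_divide)
    finally have "(\<integral>\<^sup>+v. indicator fund_dom (v, t) \<partial>lborel) = ennreal (pi / sqrt (1 - t\<^sup>2))" .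
    moreover have "t \<in> {-1/2..1/2}" using True by auto
    ultimately show ?thesis by simp
  next
    case False
    then show ?thesis by (auto simp: fund_dom_def indicator_def)
  qed
  have "emeasure lborel fund_dom = (\<integral>\<^sup>+p. indicator fund_dom p \<partial>(lborel \<Otimes>\<^sub>M lborel))"
    unfolding lborel_prod by simp
  also have "\<dots> = (\<integral>\<^sup>+t. \<integral>\<^sup>+v. indicator fund_dom (v, t) \<partial>lborel \<partial>lborel)"
    by (rule lborel_pair.nn_integral_snd[symmetric]) (unfold lborel_prod, simp)
  also have "\<dots> = (\<integral>\<^sup>+t. ennreal (pi / sqrt (1 - t\<^sup>2)) * indicator {-1/2..1/2} t \<partial>lborel)"
    by (simp add: slice)
  also have "\<dots> = ennreal (pi * arcsin (1/2) - pi * arcsin (-1/2))"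
  proof (rule nn_integral_FTC_Icc)
    fix x :: real assume "x \<in> {-1/2..1/2}"
    then have x: "-1/2 \<le> x" "x \<le> 1/2" by auto
    then have "((\<lambda>x. pi * arcsin x) has_real_derivative pi * inverse (sqrt (1 - x\<^sup>2))) (at x)"
      by (intro DERIV_cmult DERIV_arcsin) auto
    then show "((\<lambda>x. pi * arcsin x) has_real_derivative pi / sqrt (1 - x\<^sup>2)) (at x)"
      unfolding divide_inverse[of pi] .
    have "x\<^sup>2 \<le> (1/2)\<^sup>2" using x by (simp add: power2_le_iff_abs_le abs_le_iff)
    then have "1 - x\<^sup>2 > 0" by (simp add: power2_eq_square)
    then show "0 \<le> pi / sqrt (1 - x\<^sup>2)" by simp
  qed auto
  also have "pi * arcsin (1/2) - pi * arcsin (-1/2) = pi\<^sup>2 / 3"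
  proof -
    have "arcsin (1/2) = pi / 6" using arcsin_sin[of "pi / 6"] by (simp add: sin_30)
    moreover have "arcsin (-1/2) = - (pi / 6)" using arcsin_minus[of "1/2"] calculation by simp
    ultimately show ?thesis by (simp add: power2_eq_square)
  qed
  finally show ?thesis .
qed

section \<open>Sets and functions that are Borel up to null sets\<close>

lemma lebesgue_AE_eq:
  fixes B T :: "'a::euclidean_space set"
  assumes B: "B \<in> sets borel" and eq: "AE x in lborel. x \<in> T \<longleftrightarrow> x \<in> B"
  shows "T \<in> sets lebesgue" and "emeasure lebesgue T = emeasure lborel B"
proof -
  obtain M where M: "{x \<in> space lborel. \<not> (x \<in> T \<longleftrightarrow> x \<in> B)} \<subseteq> M" "emeasure lborel M = 0" "M \<in> sets lborel"
    using AE_E[OF eq] by blast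
  have Mn: "M \<in> null_sets lborel" using M by auto
  have "T = (B - M) \<union> (T \<inter> M)" using M(1) by auto
  moreover have "T \<inter> M \<in> null_sets lebesgue"
    using Mn by (intro null_sets_completion_subset[of "T \<inter> M" M]) (auto intro: null_sets_completionI)
  moreover have "B - M \<in> sets lebesgue" using B M(3) by auto
  ultimately show T: "T \<in> sets lebesgue" by (metis null_setsD2 sets.Un)
  have "emeasure lebesgue T = emeasure lebesgue B"
    using T B eq by (intro emeasure_eq_AE) (auto intro!: AE_completion)
  then show "emeasure lebesgue T = emeasure lborel B" using B by simp
qed

lemma borel_measurable_lebesgue_AE:
  fixes f g :: "'a::euclidean_space \<Rightarrow> real"
  assumes [measurable]: "f \<in> borel_measurable borel" and eq: "AE x in lborel. g x = f x"
  shows "g \<in> borel_measurable lebesgue"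
proof (rule measurableI)
  fix X :: "real set" assume [measurable]: "X \<in> sets borel"
  have "g -` X \<in> sets lebesgue"
  proof (rule lebesgue_AE_eq(1))
    show "f -` X \<in> sets borel" using measurable_sets[OF assms(1), of X] by simp
    show "AE x in lborel. x \<in> g -` X \<longleftrightarrow> x \<in> f -` X" using eq by eventually_elim simp
  qed
  then show "g -` X \<inter> space lebesgue \<in> sets lebesgue" by simp
qed simp

text \<open>The way back from \<open>ennreal\<close>: \<open>g\<close> needs no measurability
  assumption, since the completed measure supplies it from agreement with \<open>f\<close> almost
  everywhere.\<close>

lemma lebesgue_integral_AE_eq_nn_integral:
  fixes f g :: "'a::euclidean_space \<Rightarrow> real"
  assumes f [measurable]: "f \<in> borel_measurable borel" and eq: "AE x in lborel. g x = f x" and "\<And>x. 0 \<le> f x"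
  shows "(\<integral>x. g x \<partial>lebesgue) = enn2real (\<integral>\<^sup>+x. ennreal (f x) \<partial>lborel)"
proof -
  have "(\<integral>x. g x \<partial>lebesgue) = (\<integral>x. f x \<partial>lebesgue)"
    using eq borel_measurable_lebesgue_AE[OF f eq]
    by (intro integral_cong_AE) (auto intro: AE_completion measurable_completion)
  also have "\<dots> = (\<integral>x. f x \<partial>lborel)" by (rule integral_completion) simp
  also have "\<dots> = enn2real (\<integral>\<^sup>+x. ennreal (f x) \<partial>lborel)"
    using assms(3) by (intro integral_eq_nn_integral) auto
  finally show ?thesis .
qed

section \<open>Passage to Lebesgue measurable sets\<close>

lemma finite_primitive_vectors_Int:
  assumes v: "fst p \<noteq> 0" and S: "bounded S"
  shows "finite (primitive_vectors (sl2_lattice p) \<inter> S)"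
proof -
  obtain v t where p: "p = (v, t)" by (cases p)
  define w where "w = sl2_col2 v t"
  have v0: "v \<noteq> 0" using assms(1) by (simp add: p)
  obtain R where R: "\<And>x. x \<in> S \<Longrightarrow> norm x \<le> R" using S by (auto simp: bounded_iff)
  define M where "M = \<lceil>\<bar>norm v * R\<bar>\<rceil> + \<lceil>\<bar>R * norm w\<bar>\<rceil>"
  have "primitive_vectors (sl2_lattice p) \<inter> S \<subseteq>
    (\<lambda>(a, c). of_int a *\<^sub>R v + of_int c *\<^sub>R w) ` ({- M..M} \<times> {- M..M})"
  proof
    fix x assume x: "x \<in> primitive_vectors (sl2_lattice p) \<inter> S"
    then obtain a c where ac: "x = of_int a *\<^sub>R v + of_int c *\<^sub>R w"
      by (auto simp: primitive_vectors_def sl2_lattice_def lattice_of_def p w_def)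
    have xR: "norm x \<le> R" using x R by auto
    have "\<bar>real_of_int c\<bar> \<le> norm v * norm x" "\<bar>real_of_int a\<bar> \<le> norm x * norm w"
      using lattice_coeff_bounds[OF v0] by (auto simp: ac w_def)
    moreover have "norm v * norm x \<le> norm v * R" "norm x * norm w \<le> R * norm w"
      using xR by (auto intro: mult_left_mono mult_right_mono)
    ultimately have "\<bar>c\<bar> \<le> M" "\<bar>a\<bar> \<le> M" unfolding M_def by linarith+
    then show "x \<in> (\<lambda>(a, c). of_int a *\<^sub>R v + of_int c *\<^sub>R w) ` ({- M..M} \<times> {- M..M})"
      unfolding ac by (intro image_eqI[of _ _ "(a, c)"]) auto
  qed
  then show ?thesis by (rule finite_subset) simp
qed

text \<open>Both transforms count a finite set, so the \<open>infsum\<close> in the definition never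
  falls back on its default.\<close>

lemma prim_siegel_indicator:
  assumes "fst p \<noteq> 0" "bounded S"
  shows "prim_siegel (indicator S) (sl2_lattice p) = real (card (primitive_vectors (sl2_lattice p) \<inter> S))"
    and "prim_sum (indicator S) p = ennreal (real (card (primitive_vectors (sl2_lattice p) \<inter> S)))"
proof -
  let ?P = "primitive_vectors (sl2_lattice p)"
  note fin = finite_primitive_vectors_Int[OF assms]
  have "prim_siegel (indicator S) (sl2_lattice p) = (\<Sum>\<^sub>\<infinity>v\<in>?P \<inter> S. 1)"
    unfolding prim_siegel_def by (rule infsum_cong_neutral) auto
  also have "\<dots> = real (card (?P \<inter> S))" using fin by simp
  finally show "prim_siegel (indicator S) (sl2_lattice p) = real (card (?P \<inter> S))" .
  have "prim_sum (indicator S) p = (\<integral>\<^sup>+x. indicator (?P \<inter> S) x \<partial>count_space ?P)"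
    unfolding prim_sum_eq[OF assms(1)] by (intro nn_integral_cong) (auto split: split_indicator)
  also have "\<dots> = emeasure (count_space ?P) (?P \<inter> S)" by (subst nn_integral_indicator) auto
  also have "\<dots> = ennreal (real (card (?P \<inter> S)))"
    using fin by (subst emeasure_count_space_finite) (auto simp: ennreal_of_nat_eq_real_of_nat)
  finally show "prim_sum (indicator S) p = ennreal (real (card (?P \<inter> S)))" .
qed

text \<open>Null sets are handled by Rogers' formula itself: for \<open>f = 1\<^sub>N\<close>, \<open>h = 1\<close> its right-hand side
  vanishes while the transform of \<open>h\<close> is nowhere zero; exchanging \<open>f\<close> and \<open>h\<close> then shows that \<open>N\<close> meets
  almost all of the lines in null sets.\<close>

lemma AE_prim_sum_null:
  assumes N: "N \<in> null_sets lborel"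
  shows "AE p in lborel. p \<in> fund_dom \<longrightarrow> prim_sum (indicator N) p = 0"
proof -
  have [measurable]: "N \<in> sets borel" using N by auto
  have AEN: "AE v in lborel. v \<notin> N" by (rule AE_not_in[OF N])
  have 0: "(\<integral>\<^sup>+v. indicator N v * g v \<partial>lborel) = 0" for g :: "real^2 \<Rightarrow> ennreal"
  proof -
    have "(\<integral>\<^sup>+v. indicator N v * g v \<partial>lborel) = (\<integral>\<^sup>+(v::real^2). 0 \<partial>lborel)"
      using AEN by (intro nn_integral_cong_AE) auto
    then show ?thesis by simp
  qed
  have "(\<integral>\<^sup>+p. indicator fund_dom p * (prim_sum (indicator N) p * prim_sum (\<lambda>_. 1) p) \<partial>lborel) = 0"
    by (subst rogers_formula) (simp_all only: 0, simp_all)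
  then have "AE p in lborel. indicator fund_dom p * (prim_sum (indicator N) p * prim_sum (\<lambda>_. 1) p) = 0"
    by (subst (asm) nn_integral_0_iff_AE) auto
  then show ?thesis
  proof eventually_elim
    case (elim p)
    have "(1, 0) \<in> coprime_pairs" by (simp add: coprime_pairs_def)
    then have "prim_sum (\<lambda>_. 1) p \<noteq> 0"
      unfolding prim_sum_def by (subst nn_integral_0_iff_AE) (auto simp: AE_count_space)
    then show ?case using elim by auto
  qed
qed

lemma AE_line_integral_null:
  assumes N: "N \<in> null_sets lborel"
  shows "AE v in lborel. - v \<notin> N"
    and "n \<noteq> 0 \<Longrightarrow> AE v in lborel. line_integral (indicator N) n v = 0"
proof -
  have [measurable]: "N \<in> sets borel" using N by auto
  let ?c = "\<lambda>n::int. ennreal (real (totient (nat \<bar>n\<bar>)) / real (nat \<bar>n\<bar>))"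
  have "(\<integral>\<^sup>+p. indicator fund_dom p * (prim_sum (\<lambda>_. 1) p * prim_sum (indicator N) p) \<partial>lborel) = (\<integral>\<^sup>+(p::(real^2) \<times> real). 0 \<partial>lborel)"
    using AE_prim_sum_null[OF N] by (intro nn_integral_cong_AE) (auto split: split_indicator)
  then have "(\<integral>\<^sup>+p. indicator fund_dom p * (prim_sum (\<lambda>_. 1) p * prim_sum (indicator N) p) \<partial>lborel) = 0"
    by simp
  then have "2 * ((\<integral>\<^sup>+v. 1 * indicator N v \<partial>lborel) + (\<integral>\<^sup>+v. 1 * indicator N (- v) \<partial>(lborel :: (real^2) measure)) +
     (\<integral>\<^sup>+n. ?c n * (\<integral>\<^sup>+v. 1 * line_integral (indicator N) n v \<partial>lborel) \<partial>count_space {n. n \<noteq> 0})) = 0"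
    by (subst (asm) rogers_formula) simp_all
  then have R: "(\<integral>\<^sup>+v. indicator N (- v) \<partial>(lborel :: (real^2) measure)) = 0"
    "(\<integral>\<^sup>+n. ?c n * (\<integral>\<^sup>+v. line_integral (indicator N) n v \<partial>lborel) \<partial>count_space {n. n \<noteq> 0}) = 0"
    by (simp_all only: mult_1 mult_eq_0_iff add_eq_0_iff_both_eq_0) simp_all
  from R(1) have "AE v in lborel. indicator N (- (v::real^2)) = (0::ennreal)"
    by (subst (asm) nn_integral_0_iff_AE) auto
  then show "AE v in lborel. - v \<notin> N" by eventually_elim (auto split: split_indicator_asm)
  assume n: "n \<noteq> 0"
  \<comment> \<open>Positive weights are what allow the vanishing of the whole sum to be passed on
    to the single term \<open>n\<close>.\<close>
  have "totient (nat \<bar>n\<bar>) > 0" using n by simp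
  then have "?c n \<noteq> 0" using n by (simp add: ennreal_eq_0_iff)
  then have "(\<integral>\<^sup>+v. line_integral (indicator N) n v \<partial>lborel) = 0"
    using R(2) n by (subst (asm) nn_integral_0_iff_AE) (auto simp: AE_count_space)
  then show "AE v in lborel. line_integral (indicator N) n v = 0"
    by (subst (asm) nn_integral_0_iff_AE) auto
qed

section \<open>Bounds for the line sections of a bounded set\<close>

text \<open>Since |n| is the determinant of two vectors of length at most \<open>R\<close>, it is at
  most \<open>R\<^sup>2\<close>. As |n| is at least 1, the same estimate keeps |v| above 1/R, and
  this bounds |t| uniformly although \<open>v\<close> may be small.\<close>

lemma I_set_bounds:
  assumes S: "\<And>x. x \<in> S \<Longrightarrow> norm x \<le> R" and v: "v \<in> S" "v \<noteq> 0" and t: "t \<in> I_set S n v" and n: "n \<noteq> 0"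
  shows "\<bar>of_int n\<bar> \<le> R\<^sup>2" "\<bar>t\<bar> \<le> R\<^sup>2"
proof -
  define z where "z = of_int n *\<^sub>R ((1 / (norm v)\<^sup>2) *\<^sub>R perp2 v) + t *\<^sub>R v"
  have z: "norm z \<le> R" "norm v \<le> R" using t v S by (auto simp: I_set_def z_def)
  have R0: "0 \<le> R" using z(2) norm_ge_zero[of v] by linarith
  have "z = t *\<^sub>R v + of_int n *\<^sub>R sl2_col2 v 0" by (simp add: z_def sl2_col2_def)
  then have dz: "det2 v z = of_int n" and iz: "v \<bullet> z = t * (norm v)\<^sup>2"
    using det2_lincomb[of 1 v 0 "sl2_col2 v 0" t "of_int n"] det2_sl2_col2[OF v(2), of 0]
      inner_sl2_col2[OF v(2), of 0] v(2) by (auto simp: inner_add_right power2_norm_eq_inner)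
  have 1: "\<bar>of_int n\<bar> \<le> norm v * R"
    using abs_det2_le[of v z] dz mult_left_mono[OF z(1), of "norm v"] by simp
  also have "\<dots> \<le> R\<^sup>2" using mult_right_mono[OF z(2) R0] by (simp add: power2_eq_square)
  finally show "\<bar>of_int n\<bar> \<le> R\<^sup>2" .
  have "1 \<le> \<bar>real_of_int n\<bar>" using n by linarith
  then have nR: "1 \<le> norm v * R" using 1 by linarith
  have "\<bar>t\<bar> * (norm v)\<^sup>2 \<le> norm v * R"
    using Cauchy_Schwarz_ineq2[of v z] iz mult_left_mono[OF z(1), of "norm v"] by (simp add: abs_mult)
  then have "norm v * (\<bar>t\<bar> * norm v) \<le> norm v * R" by (simp add: power2_eq_square mult_ac)
  then have tv: "\<bar>t\<bar> * norm v \<le> R" using v(2) by simp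
  have "\<bar>t\<bar> * 1 \<le> \<bar>t\<bar> * (norm v * R)" using nR by (intro mult_left_mono) auto
  also have "\<dots> \<le> R * R" using mult_right_mono[OF tv R0] by (simp add: mult_ac)
  finally show "\<bar>t\<bar> \<le> R\<^sup>2" by (simp add: power2_eq_square)
qed

lemma line_integral_indicator:
  assumes [measurable]: "A \<in> sets borel"
  shows "I_set A n v \<in> sets borel" "line_integral (indicator A) n v = emeasure lborel (I_set A n v)"
proof -
  have *: "I_set A n v = (\<lambda>t. of_int n *\<^sub>R ((1 / (norm v)\<^sup>2) *\<^sub>R perp2 v) + t *\<^sub>R v) -` A \<inter> space borel"
    by (auto simp: I_set_def)
  show [measurable]: "I_set A n v \<in> sets borel" unfolding * by measurable
  have "line_integral (indicator A) n v = (\<integral>\<^sup>+t. indicator (I_set A n v) t \<partial>lborel)"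
    unfolding line_integral_def by (intro nn_integral_cong) (auto simp: I_set_def split: split_indicator)
  also have "\<dots> = emeasure lborel (I_set A n v)" by simp
  finally show "line_integral (indicator A) n v = emeasure lborel (I_set A n v)" .
qed

lemma line_integral_bounds:
  assumes A [measurable]: "A \<in> sets borel" and S: "\<And>x. x \<in> A \<Longrightarrow> norm x \<le> R" and n: "n \<noteq> 0" and v: "v \<noteq> 0"
  shows "indicator A v * line_integral (indicator A) n v \<le> ennreal (2 * R\<^sup>2) * indicator A v"
    and "R\<^sup>2 < \<bar>of_int n\<bar> \<Longrightarrow> indicator A v * line_integral (indicator A) n v = 0"
proof -
  have sub: "I_set A n v \<subseteq> {- (R\<^sup>2)..R\<^sup>2}" if "v \<in> A"
  proof
    fix t assume "t \<in> I_set A n v"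
    from I_set_bounds(2)[OF S that v this n] show "t \<in> {- (R\<^sup>2)..R\<^sup>2}" by (auto simp: abs_le_iff)
  qed
  have "emeasure lborel (I_set A n v) \<le> ennreal (2 * R\<^sup>2)" if "v \<in> A"
    using emeasure_mono[OF sub[OF that], of lborel] by simp
  then show "indicator A v * line_integral (indicator A) n v \<le> ennreal (2 * R\<^sup>2) * indicator A v"
    by (simp add: line_integral_indicator(2)[OF A] split: split_indicator)
  assume nR: "R\<^sup>2 < \<bar>of_int n\<bar>"
  have "I_set A n v = {}" if "v \<in> A"
  proof (rule equals0I)
    fix t assume "t \<in> I_set A n v"
    from I_set_bounds(1)[OF S that v this n] nR show False by simp
  qed
  then show "indicator A v * line_integral (indicator A) n v = 0"
    by (simp add: line_integral_indicator(2)[OF A] split: split_indicator)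
qed

text \<open>\<open>S\<close> is replaced by a Borel set \<open>A\<close> that agrees with it off a
  null set \<open>N\<close>, and the two-function formula is applied with both functions equal to
  the indicator of \<open>A\<close>. The factor \<open>1 / (pi\<^sup>2 / 6)\<close> is 2 divided by
  the volume of the domain.\<close>

theorem theorem2p1:
  fixes S :: "(real^2) set"
  assumes "bounded S" and "S \<in> sets lebesgue"
  shows "L2_norm_sq (prim_siegel (indicator S)) =
    (1 / (pi\<^sup>2 / 6)) *
      (measure lebesgue S + measure lebesgue (S \<inter> uminus ` S) +
       (\<Sum>\<^sub>\<infinity> n\<in>{n::int. n \<noteq> 0}.
          real (totient (nat \<bar>n\<bar>)) / real (nat \<bar>n\<bar>) *
          (\<integral>x. measure lebesgue (I_set S n x) \<partial>(lebesgue_on S))))"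
proof -
  obtain A N0 N where A: "S = A \<union> N0" "N0 \<subseteq> N" "N \<in> null_sets lborel" "A \<in> sets lborel"
    using sets_completionE[OF assms(2)] by blast
  have [measurable]: "A \<in> sets borel" "N \<in> sets borel" using A by auto
  have bA: "bounded A" using assms(1) A(1) bounded_subset by blast
  have SA: "x \<in> S \<longleftrightarrow> x \<in> A" if "x \<notin> N" for x using A(1,2) that by auto
  obtain R where R: "\<And>x. x \<in> A \<Longrightarrow> norm x \<le> R" using bA by (auto simp: bounded_iff)
  let ?f = "indicator A :: real^2 \<Rightarrow> ennreal"
  let ?c = "\<lambda>n::int. real (totient (nat \<bar>n\<bar>)) / real (nat \<bar>n\<bar>)"
  have AEN: "AE x in lborel. x \<notin> N" by (rule AE_not_in[OF A(3)])
  have finA: "emeasure lborel B < \<infinity>" if "B \<subseteq> A" for B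
    using bounded_subset[OF bA that] by (rule emeasure_bounded_finite)

  have m1: "(\<integral>\<^sup>+v. ?f v * ?f v \<partial>lborel) = ennreal (measure lebesgue S)"
  proof -
    have "emeasure lebesgue S = emeasure lborel A"
      using AEN SA by (intro lebesgue_AE_eq(2)) (auto elim: eventually_mono)
    moreover have "(\<integral>\<^sup>+v. ?f v * ?f v \<partial>lborel) = emeasure lborel A"
      by (simp add: indicator_inter_arith[symmetric])
    ultimately show ?thesis using finA[of A] by (simp add: measure_def)
  qed
  have m2: "(\<integral>\<^sup>+v. ?f v * ?f (- v) \<partial>lborel) = ennreal (measure lebesgue (S \<inter> uminus ` S))"
  proof -
    have neg: "x \<in> uminus ` X \<longleftrightarrow> - x \<in> X" for x :: "real^2" and X
      by (metis (no_types, lifting) image_iff minus_minus)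
    let ?B = "A \<inter> uminus -` A"
    have [measurable]: "?B \<in> sets borel"
      using measurable_sets[of "uminus :: real^2 \<Rightarrow> _" borel borel A] by auto
    have "AE x in lborel. x \<in> S \<inter> uminus ` S \<longleftrightarrow> x \<in> ?B"
      using AEN AE_line_integral_null(1)[OF A(3)] by eventually_elim (auto simp: SA neg)
    then have "emeasure lebesgue (S \<inter> uminus ` S) = emeasure lborel ?B"
      by (intro lebesgue_AE_eq(2)) auto
    moreover have "(\<integral>\<^sup>+v. ?f v * ?f (- v) \<partial>lborel) = (\<integral>\<^sup>+v. indicator ?B v \<partial>lborel)"
      by (intro nn_integral_cong) (auto split: split_indicator)
    ultimately show ?thesis using finA[of ?B] by (simp add: measure_def)
  qed

  \<comment> \<open>\<open>J\<close> is the term of the formula for \<open>A\<close> in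
    \<open>ennreal\<close>, \<open>j\<close> the term of the claim for \<open>S\<close> in the
    reals.\<close>
  define J where "J n = (\<integral>\<^sup>+v. ?f v * line_integral ?f n v \<partial>lborel)" for n
  define j where "j n = (\<integral>x. measure lebesgue (I_set S n x) \<partial>(lebesgue_on S))" for n
  have Jfin: "J n < \<infinity>" if n: "n \<noteq> 0" for n
  proof -
    have "J n \<le> (\<integral>\<^sup>+v. ennreal (2 * R\<^sup>2) * ?f v \<partial>lborel)"
      unfolding J_def using AE_real2_nonzero
      by (intro nn_integral_mono_AE) (auto intro!: line_integral_bounds(1) R n)
    also have "\<dots> = ennreal (2 * R\<^sup>2) * emeasure lborel A" by (simp add: nn_integral_cmult)
    also have "\<dots> < \<infinity>" using finA[of A] by (simp add: ennreal_mult_less_top)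
    finally show ?thesis .
  qed
  have J0: "J n = 0" if n: "n \<noteq> 0" "R\<^sup>2 < \<bar>of_int n\<bar>" for n
  proof -
    have "J n = (\<integral>\<^sup>+(v::real^2). 0 \<partial>lborel)"
      unfolding J_def
      by (rule nn_integral_cong_AE, rule AE_mp[OF AE_real2_nonzero], rule AE_I2, rule impI)
        (rule line_integral_bounds(2)[OF _ R n(1) _ n(2)], auto)
    then show ?thesis by simp
  qed
  have jJ: "j n = enn2real (J n)" if n: "n \<noteq> 0" for n
  proof -
    let ?h = "\<lambda>v. enn2real (?f v * line_integral ?f n v)"
    have "j n = (\<integral>x. indicator S x *\<^sub>R measure lebesgue (I_set S n x) \<partial>lebesgue)"
      unfolding j_def using assms(2) by (intro integral_restrict_space) simp
    also have "\<dots> = enn2real (\<integral>\<^sup>+x. ennreal (?h x) \<partial>lborel)"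
    proof (rule lebesgue_integral_AE_eq_nn_integral)
      show "AE x in lborel. indicator S x *\<^sub>R measure lebesgue (I_set S n x) = ?h x"
        using AEN AE_line_integral_null(2)[OF A(3) n]
      proof eventually_elim
        case (elim x)
        \<comment> \<open>The parameters at which this line meets \<open>N\<close> form a null set,
          so the sections of \<open>S\<close> and \<open>A\<close> along it have equal
          measure.\<close>
        have "(\<integral>\<^sup>+t. indicator N (of_int n *\<^sub>R ((1 / (norm x)\<^sup>2) *\<^sub>R perp2 x) + t *\<^sub>R x) \<partial>lborel) = 0"
          using elim(2) by (simp add: line_integral_def)
        then have "AE t in lborel. indicator N (of_int n *\<^sub>R ((1 / (norm x)\<^sup>2) *\<^sub>R perp2 x) + t *\<^sub>R x) = (0::ennreal)"
          by (subst (asm) nn_integral_0_iff_AE) auto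
        then have "AE t in lborel. t \<in> I_set S n x \<longleftrightarrow> t \<in> I_set A n x"
          by eventually_elim (auto simp: I_set_def SA split: split_indicator_asm)
        then have "emeasure lebesgue (I_set S n x) = line_integral ?f n x"
          unfolding line_integral_indicator(2)[OF \<open>A \<in> sets borel\<close>]
          by (intro lebesgue_AE_eq(2) line_integral_indicator(1)) auto
        then show ?case using SA[OF elim(1)] by (simp add: measure_def split: split_indicator)
      qed
    qed auto
    also have "(\<integral>\<^sup>+x. ennreal (?h x) \<partial>lborel) = J n"
      unfolding J_def
    proof (rule nn_integral_cong_AE, rule AE_mp[OF AE_real2_nonzero], rule AE_I2, rule impI)
      fix v :: "real^2" assume v: "v \<noteq> 0"
      \<comment> \<open>Finiteness matters: \<open>enn2real\<close> sends infinity to 0, so only a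
        finite value survives the round trip.\<close>
      have "?f v * line_integral ?f n v \<le> ennreal (2 * R\<^sup>2) * indicator A v"
        using R n v by (intro line_integral_bounds(1)) auto
      also have "\<dots> < \<infinity>" by (auto split: split_indicator)
      finally show "ennreal (?h v) = ?f v * line_integral ?f n v" by simp
    qed
    finally show ?thesis .
  qed

  have j0: "0 \<le> j n" and Jj: "J n = ennreal (j n)" if "n \<noteq> 0" for n
    using Jfin[OF that] by (simp_all add: jJ[OF that])

  \<comment> \<open>Outside this finite set the sections through nonzero points of \<open>A\<close>
    are empty, so the sum over all nonzero \<open>n\<close> is finite.\<close>
  define T where "T = {n::int. n \<noteq> 0 \<and> \<bar>of_int n\<bar> \<le> R\<^sup>2}"
  have T: "finite T"
  proof (rule finite_subset)
    show "T \<subseteq> {- \<lfloor>R\<^sup>2\<rfloor>..\<lfloor>R\<^sup>2\<rfloor>}"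
    proof
      fix n assume "n \<in> T"
      then have "n \<le> \<lfloor>R\<^sup>2\<rfloor>" "- n \<le> \<lfloor>R\<^sup>2\<rfloor>" by (auto simp: T_def le_floor_iff abs_le_iff)
      then show "n \<in> {- \<lfloor>R\<^sup>2\<rfloor>..\<lfloor>R\<^sup>2\<rfloor>}" by auto
    qed
  qed simp
  have sumJ: "(\<integral>\<^sup>+n. ennreal (?c n) * J n \<partial>count_space {n. n \<noteq> 0}) = ennreal (\<Sum>n\<in>T. ?c n * j n)"
  proof -
    have "(\<integral>\<^sup>+n. ennreal (?c n) * J n \<partial>count_space {n. n \<noteq> 0}) = (\<Sum>n\<in>T. ennreal (?c n) * J n)"
      using T by (intro nn_integral_count_space') (auto simp: T_def J0)
    also have "\<dots> = (\<Sum>n\<in>T. ennreal (?c n * j n))"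
    proof (intro sum.cong refl)
      fix n assume "n \<in> T"
      then have n: "n \<noteq> 0" by (simp add: T_def)
      show "ennreal (?c n) * J n = ennreal (?c n * j n)"
        unfolding Jj[OF n] by (rule ennreal_mult''[OF j0[OF n], symmetric])
    qed
    also have "\<dots> = ennreal (\<Sum>n\<in>T. ?c n * j n)"
      by (intro sum_ennreal) (simp add: T_def j0)
    finally show ?thesis .
  qed
  have infJ: "(\<Sum>\<^sub>\<infinity> n\<in>{n::int. n \<noteq> 0}. ?c n * j n) = (\<Sum>n\<in>T. ?c n * j n)"
  proof -
    have "(\<Sum>\<^sub>\<infinity> n\<in>{n::int. n \<noteq> 0}. ?c n * j n) = (\<Sum>\<^sub>\<infinity> n\<in>T. ?c n * j n)"
      by (rule infsum_cong_neutral) (auto simp: T_def jJ J0)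
    then show ?thesis using T by simp
  qed
  let ?total = "measure lebesgue S + measure lebesgue (S \<inter> uminus ` S) + (\<Sum>n\<in>T. ?c n * j n)"
  have nonneg: "0 \<le> (\<Sum>n\<in>T. ?c n * j n)"
    by (intro sum_nonneg) (simp add: T_def j0)
  have rogers: "(\<integral>\<^sup>+p. indicator fund_dom p * (prim_sum ?f p * prim_sum ?f p) \<partial>lborel) = ennreal (2 * ?total)"
  proof -
    have "(\<integral>\<^sup>+p. indicator fund_dom p * (prim_sum ?f p * prim_sum ?f p) \<partial>lborel) =
      2 * (ennreal (measure lebesgue S) + ennreal (measure lebesgue (S \<inter> uminus ` S)) + ennreal (\<Sum>n\<in>T. ?c n * j n))"
      using rogers_formula[of ?f ?f] m1 m2 sumJ by (simp add: J_def)
    also have "\<dots> = ennreal (2 * ?total)"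
    proof -
      have "ennreal (2 * ?total) = ennreal 2 * ennreal ?total" by (rule ennreal_mult') simp
      also have "ennreal ?total = ennreal (measure lebesgue S) + ennreal (measure lebesgue (S \<inter> uminus ` S))
          + ennreal (\<Sum>n\<in>T. ?c n * j n)"
        using nonneg by (simp only: ennreal_plus measure_nonneg add_nonneg_nonneg)
      finally show ?thesis by (simp only: ennreal_numeral)
    qed
    finally show ?thesis .
  qed

  let ?F = "\<lambda>p. (prim_siegel (indicator S) (sl2_lattice p))\<^sup>2"
  let ?h = "\<lambda>p. enn2real (indicator fund_dom p * (prim_sum ?f p * prim_sum ?f p))"
  have "(\<integral>p. ?F p \<partial>(lebesgue_on fund_dom)) = (\<integral>p. indicator fund_dom p *\<^sub>R ?F p \<partial>lebesgue)"
    by (intro integral_restrict_space) simp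
  also have "\<dots> = enn2real (\<integral>\<^sup>+p. ennreal (?h p) \<partial>lborel)"
  proof (rule lebesgue_integral_AE_eq_nn_integral)
    show "AE p in lborel. indicator fund_dom p *\<^sub>R ?F p = ?h p"
      using AE_prim_sum_null[OF A(3)] AE_fst_nonzero
    proof eventually_elim
      case (elim p)
      show ?case
      proof (cases "p \<in> fund_dom")
        case True
        then have "prim_sum (indicator N) p = 0" using elim(1) by simp
        \<comment> \<open>A vanishing sum of indicator values means that no primitive vector lies in
          \<open>N\<close>; for such a lattice the counts for \<open>S\<close> and \<open>A\<close>
          agree exactly.\<close>
        then have "\<forall>x\<in>primitive_vectors (sl2_lattice p). x \<notin> N"
          unfolding prim_sum_eq[OF elim(2)] by (subst (asm) nn_integral_0_iff_AE) (auto simp: AE_count_space)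
        then have "primitive_vectors (sl2_lattice p) \<inter> S = primitive_vectors (sl2_lattice p) \<inter> A"
          using SA by auto
        then show ?thesis
          using prim_siegel_indicator(1)[OF elim(2) assms(1)] prim_siegel_indicator(2)[OF elim(2) bA] True
          by (simp add: enn2real_mult power2_eq_square)
      qed simp
    qed
  qed auto
  also have "(\<integral>\<^sup>+p. ennreal (?h p) \<partial>lborel) = (\<integral>\<^sup>+p. indicator fund_dom p * (prim_sum ?f p * prim_sum ?f p) \<partial>lborel)"
  proof (rule nn_integral_cong_AE, rule AE_mp[OF AE_fst_nonzero], rule AE_I2, rule impI)
    fix p :: "(real^2) \<times> real" assume "fst p \<noteq> 0"
    then show "ennreal (?h p) = indicator fund_dom p * (prim_sum ?f p * prim_sum ?f p)"
      using prim_siegel_indicator(2)[OF _ bA] by (auto simp: ennreal_mult[symmetric] split: split_indicator)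
  qed
  also have "enn2real \<dots> = 2 * ?total"
    unfolding rogers using nonneg by (intro enn2real_ennreal) simp
  finally have "(\<integral>p. ?F p \<partial>(lebesgue_on fund_dom)) = 2 * ?total" .
  moreover have "measure lebesgue fund_dom = pi\<^sup>2 / 3"
    by (simp add: measure_def emeasure_fund_dom)
  ultimately have "L2_norm_sq (prim_siegel (indicator S)) = 2 * ?total / (pi\<^sup>2 / 3)"
    by (simp only: L2_norm_sq_def X_integral_def)
  also have "\<dots> = (1 / (pi\<^sup>2 / 6)) * ?total" by (simp add: field_simps)
  finally show ?thesis using infJ by (simp only: j_def)
qed

end
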